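(* Let $\mathcal{W}$ be a reflection group of type $A_n$, $B_n$, or $D_n$, let $\chi(t)$ be the characteristic polynomial of the associated reflection arrangement, and let $\mathcal{C}$ be any fundamental chamber of $\mathcal{W}$. Then the projection volumes $\nu_k$ of $\mathcal{C}$ are proportional to the absolute values of the coefficients of $\chi(t)$; that is, there is a constant $c>0$ such that for all integers $k\ge 0$, $\nu_k=c\,|a_k|$, where $a_k$ is the coefficient of $t^k$ in $\chi(t)$.
   Context: Groups: $A_n$ is the group of all permutations of the coordinates of $\mathbb{R}^{n+1}$, with mirrors $\{x_i=x_j\}$, $1\le i<j\le n+1$. $B_n$ is the group of all signed permutations of the coordinates of $\mathbb{R}^n$, with mirrors $\{x_i=x_j\}$, $\{x_i=-x_j\}$ ($1\le i<j\le n$) and $\{x_k=0\}$ ($1\le k\le n$). $D_n$ is the subgroup of $B_n$ of signed permutations with an even number of sign changes, with mirrors $\{x_i=x_j\}$, $\{x_i=-x_j\}$ ($1\le i<j\le n$). The reflection arrangement of a finite reflection group $\mathcal{W}$ acting on $\mathbb{R}^N$ is the collection of all mirrors (fixed hyperplanes) of reflections in $\mathcal{W}$. A fundamental chamber of $\mathcal{W}$ is the closure of a connected component (region) of the complement of the union of all these hyperplanes; it is a polyhedral cone. Characteristic polynomial: for a finite collection $\mathcal{A}$ of linear hyperplanes in $\mathbb{R}^N$, let $L(\mathcal{A})$ be the set of all intersections of subcollections of $\mathcal{A}$ (including $\mathbb{R}^N$ as the empty intersection), ordered by reverse inclusion. Define $\mu:L(\mathcal{A})\to\mathbb{Z}$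 by $\mu(\mathbb{R}^N)=1$ and $\sum_{z\le y}\mu(z)=0$ for all $y\ne\mathbb{R}^N$. Then $\chi_{\mathcal{A}}(t)=\sum_{y\in L(\mathcal{A})}\mu(y)\,t^{\dim y}$. Projection volumes: for a polyhedral cone $\mathcal{C}\subseteq\mathbb{R}^N$, $\pi_{\mathcal{C}}(y)$ is the orthogonal (Euclidean nearest-point) projection of $y$ onto $\mathcal{C}$; it is called $k$-dimensional if it lies in the relative interior of a $k$-dimensional face of $\mathcal{C}$ (where $\mathcal{C}$ itself is a face). The projection volume $\nu_k$ is the fraction, as measured by surface volume, of the unit sphere in $\mathbb{R}^N$ occupied by the points $y$ for which $\pi_{\mathcal{C}}(y)$ is $k$-dimensional. *)

theory Defs
  imports "HOL-Analysis.Analysis" "HOL-Computational_Algebra.Polynomial"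
begin

definition coord_perm :: "('m::finite \<Rightarrow> 'm) \<Rightarrow> real^'m \<Rightarrow> real^'m"
  where "coord_perm p x = (\<chi> i. x $ p i)"

definition signed_perm :: "('m::finite \<Rightarrow> real) \<Rightarrow> ('m \<Rightarrow> 'm) \<Rightarrow> real^'m \<Rightarrow> real^'m"
  where "signed_perm s p x = (\<chi> i. s i * x $ p i)"

definition type_A :: "nat \<Rightarrow> (real^'m::finite \<Rightarrow> real^'m) set \<Rightarrow> bool"
  where "type_A n W \<longleftrightarrow> CARD('m) = n + 1 \<and> W = {coord_perm p | p. bij p}"

definition type_B :: "nat \<Rightarrow> (real^'m::finite \<Rightarrow> real^'m) set \<Rightarrow> bool"
  where "type_B n W \<longleftrightarrow> CARD('m) = n \<and>
     W = {signed_perm s p | s p. bij p \<and> (\<forall>i. s i \<in> {1, -1})}"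

definition type_D :: "nat \<Rightarrow> (real^'m::finite \<Rightarrow> real^'m) set \<Rightarrow> bool"
  where "type_D n W \<longleftrightarrow> CARD('m) = n \<and>
     W = {signed_perm s p | s p. bij p \<and> (\<forall>i. s i \<in> {1, -1}) \<and> even (card {i. s i = -1})}"

definition is_reflection :: "('a::euclidean_space \<Rightarrow> 'a) \<Rightarrow> bool"
  where "is_reflection f \<longleftrightarrow> (\<exists>a. a \<noteq> 0 \<and> f = (\<lambda>x. x - (2 * (x \<bullet> a) / (a \<bullet> a)) *\<^sub>R a))"

definition mirror :: "('a \<Rightarrow> 'a) \<Rightarrow> 'a set"
  where "mirror f = {x. f x = x}"

definition reflection_arrangement :: "('a::euclidean_space \<Rightarrow> 'a) set \<Rightarrow> 'a set set"
  where "reflection_arrangement W = mirror ` {f \<in> W. is_reflection f}"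

definition fundamental_chamber :: "('a::euclidean_space \<Rightarrow> 'a) set \<Rightarrow> 'a set \<Rightarrow> bool"
  where "fundamental_chamber W C \<longleftrightarrow>
    (\<exists>R \<in> components (- \<Union>(reflection_arrangement W)). C = closure R)"

text \<open>The empty subcollection contributes \<^term>\<open>\<Inter>{} = UNIV\<close>, the whole space.\<close>

definition intersection_lattice :: "'a set set \<Rightarrow> 'a set set"
  where "intersection_lattice A = {\<Inter>B | B. B \<subseteq> A}"

text \<open>
  The order is reverse inclusion, so the sum below is over all \<open>z < y\<close>. The finiteness test only
  serves to make the recursion terminate; lemma \<open>sum_mobius\<close> gives the usual defining equation.
\<close>

function mobius :: "'a set set \<Rightarrow> 'a set \<Rightarrow> int"
  where "mobius L y = (if infinite L then 0 else if y = UNIV then 1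
                       else - (\<Sum>z | z \<in> L \<and> y \<subset> z. mobius L z))"
  by auto
termination
proof (relation "Wellfounded.measure (\<lambda>(L, y). card {z \<in> L. y \<subset> z})", goal_cases)
  case (2 L y z)
  then have "{w \<in> L. z \<subset> w} \<subset> {w \<in> L. y \<subset> w}" "finite {w \<in> L. y \<subset> w}"
    by auto
  then show ?case by (simp add: psubset_card_mono)
qed simp

declare mobius.simps [simp del]

lemma mobius_UNIV: "finite L \<Longrightarrow> mobius L UNIV = 1"
  by (simp add: mobius.simps)

lemma sum_mobius:
  assumes "finite L" "y \<in> L" "y \<noteq> UNIV"
  shows "(\<Sum>z | z \<in> L \<and> y \<subseteq> z. mobius L z) = 0"
proof -
  have "{z. z \<in> L \<and> y \<subseteq> z} = insert y {z. z \<in> L \<and> y \<subset> z}"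
    using assms by auto
  then have "(\<Sum>z | z \<in> L \<and> y \<subseteq> z. mobius L z)
      = mobius L y + (\<Sum>z | z \<in> L \<and> y \<subset> z. mobius L z)"
    using assms by simp
  then show ?thesis
    using assms by (simp add: mobius.simps[of L y])
qed

definition characteristic_poly :: "'a::euclidean_space set set \<Rightarrow> int poly"
  where "characteristic_poly A =
    (\<Sum>y \<in> intersection_lattice A. monom (mobius (intersection_lattice A) y) (dim y))"

text \<open>
  Surface volume on the unit sphere of an \<open>N\<close>-dimensional space, by the usual polar-coordinate
  definition: \<open>N\<close> times the Lebesgue measure of the part of the unit ball lying radially
  below the given subset \<open>S\<close> of the sphere.
\<close>

definition sphere_volume :: "'a::euclidean_space set \<Rightarrow> real"
  where "sphere_volume S =
    DIM('a) * measure lebesgue {t *\<^sub>R y | t y. 0 < t \<and> t \<le> 1 \<and> y \<in> S}"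

text \<open>
  Faces are those of \<^const>\<open>face_of\<close>, which include \<open>C\<close> itself; the empty face contributes nothing
  since its relative interior is empty.
\<close>

definition k_dimensional :: "'a::euclidean_space set \<Rightarrow> nat \<Rightarrow> 'a \<Rightarrow> bool"
  where "k_dimensional C k x \<longleftrightarrow>
    (\<exists>F. F face_of C \<and> aff_dim F = int k \<and> x \<in> rel_interior F)"

definition projection_volume :: "'a::euclidean_space set \<Rightarrow> nat \<Rightarrow> real"
  where "projection_volume C k =
    sphere_volume {y \<in> sphere 0 1. k_dimensional C k (closest_point C y)}
      / sphere_volume (sphere 0 1 :: 'a set)"

lemma sphere_volume_sphere:
  "sphere_volume (sphere 0 1 :: 'a::euclidean_space set)
     = DIM('a) * measure lebesgue (cball 0 1 :: 'a set)"
proof -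
  have eq: "{t *\<^sub>R y | t y. 0 < t \<and> t \<le> 1 \<and> y \<in> sphere 0 1} = cball 0 1 - {0 :: 'a}"
  proof (intro set_eqI iffI)
    fix x :: 'a assume "x \<in> cball 0 1 - {0}"
    then have "x = norm x *\<^sub>R (x /\<^sub>R norm x) \<and> 0 < norm x \<and> norm x \<le> 1 \<and> x /\<^sub>R norm x \<in> sphere 0 1"
      by auto
    then show "x \<in> {t *\<^sub>R y | t y. 0 < t \<and> t \<le> 1 \<and> y \<in> sphere 0 1}" by blast
  qed auto
  have "measure lebesgue (cball 0 1 - {0 :: 'a}) = measure lebesgue (cball 0 1 :: 'a set)"
    by (rule measure_negligible_symdiff) (auto intro: negligible_subset[of "{0}"])
  then show ?thesis
    unfolding sphere_volume_def eq by simp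
qed

lemma mirror_eq_hyperplane:
  fixes a :: "'a::euclidean_space"
  assumes "a \<noteq> 0" "f = (\<lambda>x. x - (2 * (x \<bullet> a) / (a \<bullet> a)) *\<^sub>R a)"
  shows "mirror f = {x. x \<bullet> a = 0}"
  using assms by (auto simp: mirror_def)

lemma mirror_signed_perm_reflection:
  fixes p :: "'m::finite \<Rightarrow> 'm"
  assumes r: "is_reflection (signed_perm s p)"
  obtains i where "mirror (signed_perm s p) = {x. s i * x $ p i = x $ i}" "p i \<noteq> i \<or> s i \<noteq> 1"
proof -
  obtain a where a: "a \<noteq> 0"
    "signed_perm s p = (\<lambda>x. x - (2 * (x \<bullet> a) / (a \<bullet> a)) *\<^sub>R a)"
    using r by (auto simp: is_reflection_def)
  obtain i where i: "a $ i \<noteq> 0" using a(1) by (auto simp: vec_eq_iff)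
  have eq: "s i * x $ p i = x $ i - (2 * (x \<bullet> a) / (a \<bullet> a)) * a $ i" for x
    using arg_cong[OF fun_cong[OF a(2), of x], of "\<lambda>v. v $ i"] by (simp add: signed_perm_def)
  have iff: "s i * x $ p i = x $ i \<longleftrightarrow> x \<bullet> a = 0" for x
    unfolding eq using i a(1) by simp
  have "p i \<noteq> i \<or> s i \<noteq> 1" using iff[of a] a(1) by auto
  moreover have "mirror (signed_perm s p) = {x. s i * x $ p i = x $ i}"
    by (simp only: mirror_eq_hyperplane[OF a] iff)
  ultimately show ?thesis using that by blast
qed

lemma reflection_swap:
  fixes i j :: "'m::finite"
  assumes "i \<noteq> j" and c: "c \<in> {1, -1 :: real}"
  defines "f \<equiv> signed_perm ((\<lambda>_. 1)(i := c, j := c)) (Transposition.transpose i j)"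
  shows "is_reflection f" "mirror f = {x. x $ i = c * x $ j}"
proof -
  let ?a = "axis i 1 - c *\<^sub>R axis j 1 :: real^'m"
  have a0: "?a \<noteq> 0" using assms(1) by (auto simp: vec_eq_iff axis_def)
  have aa: "?a \<bullet> ?a = 2" using assms(1) c
    by (auto simp: inner_diff_left inner_diff_right inner_axis_axis)
  have xa: "x \<bullet> ?a = x $ i - c * x $ j" for x :: "real^'m"
    by (simp add: inner_diff_right inner_axis)
  have "signed_perm ((\<lambda>_. 1)(i := c, j := c)) (Transposition.transpose i j) x $ k
      = (x - (x $ i - c * x $ j) *\<^sub>R ?a) $ k" for x k
    using assms(1) c
    by (cases "k = i"; cases "k = j") (auto simp: signed_perm_def axis_def)
  then have "f x = x - (x \<bullet> ?a) *\<^sub>R ?a" for x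
    unfolding xa f_def vec_eq_iff by blast
  moreover have "2 * (x \<bullet> ?a) / (?a \<bullet> ?a) = x \<bullet> ?a" for x
    by (subst aa) simp
  ultimately have f: "f = (\<lambda>x. x - (2 * (x \<bullet> ?a) / (?a \<bullet> ?a)) *\<^sub>R ?a)"
    by presburger
  show "is_reflection f" unfolding is_reflection_def using a0 f by blast
  show "mirror f = {x. x $ i = c * x $ j}"
    unfolding mirror_eq_hyperplane[OF a0 f] xa by simp
qed

lemma reflection_negate:
  fixes i :: "'m::finite"
  defines "f \<equiv> signed_perm ((\<lambda>_. 1)(i := -1)) id"
  shows "is_reflection f" "mirror f = {x. x $ i = 0}"
proof -
  let ?a = "axis i 1 :: real^'m"
  have a0: "?a \<noteq> 0" by (simp add: axis_eq_0_iff)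
  have f: "f = (\<lambda>x. x - (2 * (x \<bullet> ?a) / (?a \<bullet> ?a)) *\<^sub>R ?a)"
    unfolding inner_axis inner_axis_axis
    by (auto simp: f_def fun_eq_iff vec_eq_iff signed_perm_def axis_def)
  show "is_reflection f" unfolding is_reflection_def using a0 f by blast
  show "mirror f = {x. x $ i = 0}"
    unfolding mirror_eq_hyperplane[OF a0 f] by (simp add: inner_axis)
qed

lemma coord_perm_eq_signed_perm: "coord_perm p = signed_perm (\<lambda>_. 1) p"
  by (simp add: fun_eq_iff coord_perm_def signed_perm_def)

lemma reflection_arrangement_A:
  fixes W :: "(real^'m::finite \<Rightarrow> real^'m) set"
  assumes "type_A n W"
  shows "reflection_arrangement W = {{x. x $ i = x $ j} | i j. i \<noteq> j}"
proof (intro equalityI subsetI)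
  fix H assume "H \<in> reflection_arrangement W"
  then obtain p where H: "H = mirror (coord_perm p)" "is_reflection (coord_perm p)"
    using assms by (auto simp: reflection_arrangement_def type_A_def)
  from mirror_signed_perm_reflection[OF H(2)[unfolded coord_perm_eq_signed_perm]]
  obtain i where "H = {x. x $ p i = x $ i}" "p i \<noteq> i"
    unfolding H(1) coord_perm_eq_signed_perm by auto
  then show "H \<in> {{x. x $ i = x $ j} | i j. i \<noteq> j}" by blast
next
  fix H :: "(real^'m) set" assume "H \<in> {{x. x $ i = x $ j} | i j. i \<noteq> j}"
  then obtain i j where ij: "i \<noteq> j" "H = {x. x $ i = x $ j}" by blast
  have s: "(\<lambda>_. 1)(i := 1, j := 1 :: real) = (\<lambda>_. 1)" by auto
  have "coord_perm (Transposition.transpose i j) \<in> W"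
    using assms by (auto simp: type_A_def)
  then show "H \<in> reflection_arrangement W"
    using reflection_swap[OF ij(1), of 1] ij(2)
    by (auto simp: s coord_perm_eq_signed_perm reflection_arrangement_def)
qed

lemma signed_hyperplanes:
  "{{x. x $ i = x $ j} | i j. i \<noteq> j} \<union> {{x. x $ i = - x $ j} | i j. i \<noteq> j}
     = {{x :: real^'m::finite. x $ i = c * x $ j} | i j c. i \<noteq> j \<and> c \<in> {1, -1}}"
  (is "?A \<union> ?B = ?C")
proof (intro equalityI subsetI)
  fix H assume "H \<in> ?A \<union> ?B"
  then obtain i j where ij: "i \<noteq> j" and "H = {x. x $ i = x $ j} \<or> H = {x. x $ i = - x $ j}"
    by blast
  then have "H = {x. x $ i = 1 * x $ j} \<or> H = {x. x $ i = -1 * x $ j}"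
    by simp
  then show "H \<in> ?C" using ij by blast
next
  fix H assume "H \<in> ?C"
  then obtain i j c where ij: "i \<noteq> j" and c: "c \<in> {1, -1}" "H = {x. x $ i = c * x $ j}"
    by blast
  then have "H = {x. x $ i = x $ j} \<or> H = {x. x $ i = - x $ j}"
    by (elim insertE) simp_all
  then show "H \<in> ?A \<union> ?B" using ij by blast
qed

lemma reflection_arrangement_B:
  fixes W :: "(real^'m::finite \<Rightarrow> real^'m) set"
  assumes "type_B n W"
  shows "reflection_arrangement W =
    {{x. x $ i = x $ j} | i j. i \<noteq> j} \<union> {{x. x $ i = - x $ j} | i j. i \<noteq> j} \<union> {{x. x $ i = 0} | i. True}"
    (is "_ = ?M")
proof (intro equalityI subsetI)
  fix H assume "H \<in> reflection_arrangement W"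
  then obtain s p where H: "H = mirror (signed_perm s p)" "is_reflection (signed_perm s p)"
      and s: "\<And>i. s i = 1 \<or> s i = -1"
    using assms by (auto simp: reflection_arrangement_def type_B_def)
  from mirror_signed_perm_reflection[OF H(2)]
  obtain i where i: "H = {x. s i * x $ p i = x $ i}" "p i \<noteq> i \<or> s i \<noteq> 1"
    unfolding H(1) by blast
  consider "p i = i" "s i = -1" | "p i \<noteq> i" "s i = 1" | "p i \<noteq> i" "s i = -1"
    using i(2) s[of i] by auto
  then show "H \<in> ?M"
  proof cases
    case 1
    then have "H = {x. x $ i = 0}" using i(1) by auto
    then show ?thesis by blast
  next
    case 2
    then have "H = {x. x $ p i = x $ i}" using i(1) by auto
    then have "H = {x. x $ i = x $ p i}" by (simp add: eq_commute)
    then have "H \<in> {{x. x $ i = x $ j} | i j. i \<noteq> j}" using not_sym[OF 2(1)] by blast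
    then show ?thesis by simp
  next
    case 3
    then have "H = {x. x $ i = - x $ p i}" using i(1) by auto
    then have "H \<in> {{x. x $ i = - x $ j} | i j. i \<noteq> j}" using not_sym[OF 3(1)] by blast
    then show ?thesis by simp
  qed
next
  fix H assume "H \<in> ?M"
  then consider i j c where "i \<noteq> j" "c \<in> {1, -1}" "H = {x. x $ i = c * x $ j}"
    | i where "H = {x. x $ i = 0}" unfolding signed_hyperplanes by blast
  then show "H \<in> reflection_arrangement W"
  proof cases
    case (1 i j c)
    have "signed_perm ((\<lambda>_. 1)(i := c, j := c)) (Transposition.transpose i j) \<in> W"
    proof -
      have "\<forall>k. ((\<lambda>_. 1)(i := c, j := c)) k \<in> {1, -1}" using 1(2) by auto
      moreover have "bij (Transposition.transpose i j)" by simp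
      ultimately show ?thesis using assms unfolding type_B_def by blast
    qed
    then show ?thesis
      using reflection_swap[OF 1(1,2)] 1(3) by (auto simp: reflection_arrangement_def)
  next
    case (2 i)
    have "signed_perm ((\<lambda>_. 1)(i := -1)) id \<in> W"
    proof -
      have "\<forall>k. ((\<lambda>_. 1)(i := -1)) k \<in> {1, -1 :: real}" by auto
      moreover have "bij (id :: 'm \<Rightarrow> 'm)" by simp
      ultimately show ?thesis using assms unfolding type_B_def by blast
    qed
    then show ?thesis
      using reflection_negate[of i] 2 by (auto simp: reflection_arrangement_def)
  qed
qed

lemma reflection_arrangement_D:
  fixes W :: "(real^'m::finite \<Rightarrow> real^'m) set"
  assumes "type_D n W"
  shows "reflection_arrangement W =
    {{x. x $ i = x $ j} | i j. i \<noteq> j} \<union> {{x. x $ i = - x $ j} | i j. i \<noteq> j}"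
    (is "_ = ?M")
proof (intro equalityI subsetI)
  fix H assume "H \<in> reflection_arrangement W"
  then obtain s p where H: "H = mirror (signed_perm s p)" "is_reflection (signed_perm s p)"
      and s: "\<And>i. s i = 1 \<or> s i = -1" and ev: "even (card {i. s i = -1})"
    using assms by (auto simp: reflection_arrangement_def type_D_def)
  from mirror_signed_perm_reflection[OF H(2)]
  obtain i where i: "H = {x. s i * x $ p i = x $ i}" "p i \<noteq> i \<or> s i \<noteq> 1"
    unfolding H(1) by blast
  have "\<exists>k. p k \<noteq> k \<and> H = {x. s k * x $ p k = x $ k}"
  proof (cases "p i = i")
    case False
    then show ?thesis using i(1) by blast
  next
    case True
    then have si: "s i = -1" using i(2) s[of i] by auto
    have H0: "H = {x. x $ i = 0}" unfolding i(1) True si by auto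
    have fixed: "p j = j \<and> s j = 1" if "j \<noteq> i" for j
    proof -
      have "axis j 1 \<in> H" unfolding H0 using that by (simp add: axis_def)
      then have "signed_perm s p (axis j 1) = axis j 1" unfolding H(1) mirror_def by simp
      from arg_cong[OF this, of "\<lambda>v. v $ j"] show ?thesis
        by (auto simp: signed_perm_def axis_def split: if_splits)
    qed
    have "{j. s j = -1} = {i}" using fixed si by force
    then show ?thesis using ev by simp
  qed
  then obtain k where k: "p k \<noteq> k" "H = {x. s k * x $ p k = x $ k}" by blast
  have "H = {x. x $ k = x $ p k} \<or> H = {x. x $ k = - x $ p k}"
    using s[of k] unfolding k(2) by auto
  then show "H \<in> ?M"
  proof
    assume "H = {x. x $ k = x $ p k}"
    then have "H \<in> {{x. x $ i = x $ j} | i j. i \<noteq> j}" using not_sym[OF k(1)] by blast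
    then show ?thesis by simp
  next
    assume "H = {x. x $ k = - x $ p k}"
    then have "H \<in> {{x. x $ i = - x $ j} | i j. i \<noteq> j}" using not_sym[OF k(1)] by blast
    then show ?thesis by simp
  qed
next
  fix H assume "H \<in> ?M"
  then obtain i j c where 1: "i \<noteq> j" "c \<in> {1, -1}" "H = {x. x $ i = c * x $ j}"
    unfolding signed_hyperplanes by blast
  let ?s = "(\<lambda>_. 1)(i := c, j := c)"
  have "{k. ?s k = -1} = (if c = 1 then {} else {i, j})" using 1(2) by auto
  then have "even (card {k. ?s k = -1})" using 1(1) by simp
  moreover have "\<forall>k. ?s k \<in> {1, -1}" using 1(2) by auto
  moreover have "bij (Transposition.transpose i j)" by simp
  ultimately have "signed_perm ?s (Transposition.transpose i j) \<in> W"
    using assms unfolding type_D_def by blast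
  then show "H \<in> reflection_arrangement W"
    using reflection_swap[OF 1(1,2)] 1(3) by (auto simp: reflection_arrangement_def)
qed

end

theory Submission
  imports Defs
begin

text \<open>
  For every point \<open>y\<close> and every function \<open>f\<close>, the sum of \<open>f (\<pi>\<^sub>C y)\<close> over all chambers \<open>C\<close> of an
  arrangement satisfies a deletion-restriction recursion: if a hyperplane \<open>H\<close> cuts \<open>C\<close> into two
  pieces, the projection to one piece is \<open>\<pi>\<^sub>C y\<close> and the projection to the other one is the projection
  to \<open>C \<inter> H\<close>. Unrolling it expresses the sum as a signed sum of \<open>f (\<pi>\<^sub>M y)\<close> over flats \<open>M\<close>, with the
  same weights as in Whitney's formula for the characteristic polynomial. When \<open>f\<close> tests whether the
  smallest flat through a point has dimension \<open>k\<close>, this says that for almost all \<open>y\<close> exactly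
  \<open>\<bar>a\<^sub>k\<bar>\<close> chambers have a \<open>k\<close>-dimensional projection of \<open>y\<close>. Integrating over the unit ball,
  the \<open>\<nu>\<^sub>k\<close> of all chambers sum to \<open>\<bar>a\<^sub>k\<bar>\<close>, and since the group permutes the chambers transitively by
  isometries, each of them contributes the same amount.
\<close>

section \<open>Projections to the cells of an arrangement\<close>

lemma closest_point_subset:
  fixes S T :: "'a::euclidean_space set"
  assumes "closed S" "convex S" "T \<subseteq> S" "closed T" "convex T" "closest_point S y \<in> T"
  shows "closest_point T y = closest_point S y"
proof -
  have "\<forall>z\<in>T. dist y (closest_point S y) \<le> dist y z"
    using assms(1,3) closest_point_le by blast
  then show ?thesis
    using closest_point_unique[OF assms(5,4,6)] by simp
qed

text \<open>From a point \<open>x\<close> on the far side, the segment to the nearest point of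
  \<open>S\<close> stays in \<open>S\<close> and in the ball of radius \<open>dist y x\<close> about
  \<open>y\<close>, and it crosses the hyperplane. So no point of the far side beats the best point
  of the slice.\<close>

lemma closest_point_halfspace:
  fixes S :: "'a::euclidean_space set"
  assumes S: "closed S" "convex S" and p: "p \<in> S" "h \<bullet> p = 0"
    and z: "h \<bullet> closest_point S y \<ge> 0"
  shows "closest_point (S \<inter> {x. h \<bullet> x \<ge> 0}) y = closest_point S y"
    and "closest_point (S \<inter> {x. h \<bullet> x \<le> 0}) y = closest_point (S \<inter> {x. h \<bullet> x = 0}) y"
proof -
  have cl: "closed (S \<inter> {x. h \<bullet> x \<ge> 0})" "closed (S \<inter> {x. h \<bullet> x \<le> 0})"
      "closed (S \<inter> {x. h \<bullet> x = 0})"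
    using S(1) by (auto intro!: closed_Int closed_halfspace_ge closed_halfspace_le closed_hyperplane)
  have co: "convex (S \<inter> {x. h \<bullet> x \<ge> 0})" "convex (S \<inter> {x. h \<bullet> x \<le> 0})"
    using S(2) by (auto intro!: convex_Int convex_halfspace_ge convex_halfspace_le)
  have zS: "closest_point S y \<in> S"
    using S p closest_point_in_set by blast
  then show "closest_point (S \<inter> {x. h \<bullet> x \<ge> 0}) y = closest_point S y"
    using S cl co z by (intro closest_point_subset) auto
  let ?w = "closest_point (S \<inter> {x. h \<bullet> x = 0}) y"
  have w: "?w \<in> S \<inter> {x. h \<bullet> x = 0}"
    using closest_point_in_set[OF cl(3)] p by blast
  have "dist y ?w \<le> dist y x" if x: "x \<in> S \<inter> {x. h \<bullet> x \<le> 0}" for x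
  proof -
    have "connected (closed_segment x (closest_point S y))" by simp
    then obtain x' where x': "x' \<in> closed_segment x (closest_point S y)" "h \<bullet> x' = 0"
      using connected_ivt_hyperplane[of _ x "closest_point S y" h 0] x z by auto
    have "x' \<in> S"
      using x' x zS S(2) closed_segment_subset by blast
    then have "dist y ?w \<le> dist y x'"
      using x'(2) by (intro closest_point_le[OF cl(3)]) auto
    moreover have "closed_segment x (closest_point S y) \<subseteq> cball y (dist y x)"
      using S x closest_point_le[OF S(1)] by (intro closed_segment_subset) auto
    ultimately show ?thesis using x'(1) by force
  qed
  then have "?w = closest_point (S \<inter> {x. h \<bullet> x \<le> 0}) y"
    using w by (intro closest_point_unique[OF co(2) cl(2)]) auto
  then show "closest_point (S \<inter> {x. h \<bullet> x \<le> 0}) y = ?w" by simp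
qed

text \<open>The value 0 on the empty set lets sums run over all sign patterns, realised or not. The
  closure is taken because cells are only relatively open.\<close>

definition proj_value :: "('a::euclidean_space \<Rightarrow> real) \<Rightarrow> 'a \<Rightarrow> 'a set \<Rightarrow> real"
  where "proj_value f y K = (if K = {} then 0 else f (closest_point (closure K) y))"

text \<open>A nonempty convex set that is open in \<open>U\<close> has affine hull \<open>U\<close>
  and is its own relative interior; closure commutes with the intersection of convex sets whose
  relative interiors meet.\<close>

lemma closure_Int_relatively_open_convex:
  fixes K L :: "'a::euclidean_space set"
  assumes "convex K" "openin (top_of_set U) K" "affine U" "convex L" "rel_interior L = L"
      "K \<inter> L \<noteq> {}"
  shows "closure (K \<inter> L) = closure K \<inter> closure L"
proof (rule closure_Int_convex[OF assms(1,4)])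
  have "affine hull K = U"
    using assms affine_hull_openin[of U K] by (metis Int_empty_left hull_same)
  then have "rel_interior K = K"
    using assms(2) by (simp add: rel_interior_openin)
  then show "rel_interior K \<inter> rel_interior L \<noteq> {}" using assms(5,6) by simp
qed

lemma relatively_open_meets_halfspace:
  fixes h :: "'a::euclidean_space"
  assumes K: "openin (top_of_set U) K" "subspace U" and h: "\<not> U \<subseteq> {x. h \<bullet> x = 0}"
    and p: "p \<in> K" "h \<bullet> p = 0"
  shows "K \<inter> {x. h \<bullet> x > 0} \<noteq> {}"
proof -
  obtain u where u: "u \<in> U" "h \<bullet> u \<noteq> 0" using h by blast
  \<comment> \<open>The factor makes \<open>h \<bullet> v\<close> a nonzero square, whatever the
    sign of \<open>h \<bullet> u\<close>.\<close>
  define v where "v = (h \<bullet> u) *\<^sub>R u"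
  have v: "v \<in> U" "h \<bullet> v > 0"
    using u K(2) by (auto simp: v_def subspace_scale zero_less_mult_iff)
  obtain T where T: "open T" "K = U \<inter> T" using K(1) by (auto simp: openin_open)
  obtain e where e: "e > 0" "ball p e \<subseteq> T"
    using T p openE by blast
  define t where "t = e / (2 * norm v)"
  have nv: "norm v > 0" using v by auto
  have t: "t > 0" "t * norm v < e" using e nv by (auto simp: t_def)
  have "p + t *\<^sub>R v \<in> ball p e" using t by (simp add: dist_norm)
  moreover have "p + t *\<^sub>R v \<in> U"
    using p v T K(2) by (auto intro: subspace_add subspace_scale)
  moreover have "h \<bullet> (p + t *\<^sub>R v) > 0" using p v t by (simp add: inner_add_right)
  ultimately show ?thesis using T e by blast
qed

text \<open>The deletion-restriction step. If \<open>K\<close> misses the hyperplane, connectedness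
  puts it on one side. Otherwise both sides are nonempty; the one containing the projection to
  \<open>K\<close> keeps it, and the other projects as the slice does.\<close>

lemma proj_value_split:
  fixes K :: "'a::euclidean_space set"
  assumes K: "convex K" "openin (top_of_set U) K" "subspace U"
    and h: "\<not> U \<subseteq> {x. h \<bullet> x = 0}"
  shows "proj_value f y (K \<inter> {x. h \<bullet> x < 0}) + proj_value f y (K \<inter> {x. h \<bullet> x > 0})
       = proj_value f y K + proj_value f y (K \<inter> {x. h \<bullet> x = 0})"
proof (cases "K \<inter> {x. h \<bullet> x = 0} = {}")
  case True
  have "K \<inter> {x. h \<bullet> x < 0} = {} \<or> K \<inter> {x. h \<bullet> x > 0} = {}"
  proof (rule ccontr)
    assume "\<not> ?thesis"
    then obtain x x' where "x \<in> K" "x' \<in> K" "h \<bullet> x < 0" "h \<bullet> x' > 0" by blast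
    then show False
      using connected_ivt_hyperplane[of K x x' h 0] convex_connected[OF K(1)] True by auto
  qed
  then have "K \<inter> {x. h \<bullet> x < 0} = {} \<and> K \<inter> {x. h \<bullet> x > 0} = K
      \<or> K \<inter> {x. h \<bullet> x > 0} = {} \<and> K \<inter> {x. h \<bullet> x < 0} = K"
    using True by (auto simp: set_eq_iff) (metis linorder_neqE)+
  then show ?thesis using True by (auto simp: proj_value_def)
next
  case False
  then obtain p where p: "p \<in> K" "h \<bullet> p = 0" by blast
  have h0: "h \<noteq> 0" using h by auto
  have ne: "K \<inter> {x. h \<bullet> x > 0} \<noteq> {}" "K \<inter> {x. h \<bullet> x < 0} \<noteq> {}"
    using relatively_open_meets_halfspace[OF K(2,3) _ p(1), of h]
      relatively_open_meets_halfspace[OF K(2,3) _ p(1), of "-h"] h p(2) by auto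
  have aff: "affine U" using K(3) by (rule subspace_imp_affine)
  have cl: "closure (K \<inter> {x. h \<bullet> x > 0}) = closure K \<inter> {x. h \<bullet> x \<ge> 0}"
      "closure (K \<inter> {x. h \<bullet> x < 0}) = closure K \<inter> {x. h \<bullet> x \<le> 0}"
      "closure (K \<inter> {x. h \<bullet> x = 0}) = closure K \<inter> {x. h \<bullet> x = 0}"
    using closure_Int_relatively_open_convex[OF K(1,2) aff convex_halfspace_gt[of 0 h]]
      closure_Int_relatively_open_convex[OF K(1,2) aff convex_halfspace_lt[of h 0]]
      closure_Int_relatively_open_convex[OF K(1,2) aff convex_hyperplane[of h 0]]
      ne False h0
    by (simp_all add: rel_interior_open open_halfspace_gt open_halfspace_lt closure_halfspace_gt
        closure_halfspace_lt rel_interior_affine affine_hyperplane closed_hyperplane)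
  have S: "closed (closure K)" "convex (closure K)" "p \<in> closure K"
    using K p closure_subset by (auto simp: convex_closure)
  show ?thesis
  proof (cases "h \<bullet> closest_point (closure K) y \<ge> 0")
    case True
    show ?thesis
      using closest_point_halfspace[OF S p(2) True] ne p False
      by (auto simp: proj_value_def cl)
  next
    case neg: False
    \<comment> \<open>Passing from \<open>h\<close> to \<open>- h\<close> exchanges the two
      sides.\<close>
    have "- h \<bullet> p = 0" "- h \<bullet> closest_point (closure K) y \<ge> 0" using p neg by auto
    from closest_point_halfspace[OF S this]
    show ?thesis
      using ne p False by (auto simp: proj_value_def cl)
  qed
qed

section \<open>Cells of a sign pattern and the deletion-restriction sum\<close>

text \<open>\<open>P\<close> lists the vectors of \<open>V\<close> that are positive on the cell.
  The subspace \<open>U\<close> is a parameter so that restriction to a hyperplane yields cells of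
  the same kind.\<close>

definition cell :: "'a::euclidean_space set \<Rightarrow> 'a set \<Rightarrow> 'a set \<Rightarrow> 'a set"
  where "cell V U P = {x \<in> U. (\<forall>a\<in>P. a \<bullet> x > 0) \<and> (\<forall>a\<in>V - P. a \<bullet> x < 0)}"

lemma cell_eq_Int: "cell V U P = U \<inter> (\<Inter>a\<in>P. {x. a \<bullet> x > 0}) \<inter> (\<Inter>a\<in>V - P. {x. a \<bullet> x < 0})"
  by (auto simp: cell_def)

lemma convex_cell: "convex U \<Longrightarrow> convex (cell V U P)"
  unfolding cell_eq_Int
  by (intro convex_Int convex_INT) (auto simp: convex_halfspace_gt convex_halfspace_lt)

lemma openin_cell:
  assumes "finite V" "P \<subseteq> V"
  shows "openin (top_of_set U) (cell V U P)"
proof -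
  have "open ((\<Inter>a\<in>P. {x. a \<bullet> x > 0}) \<inter> (\<Inter>a\<in>V - P. {x. a \<bullet> x < 0}))"
    using assms finite_subset
    by (intro open_Int open_INT) (auto simp: open_halfspace_gt open_halfspace_lt)
  then show ?thesis unfolding cell_eq_Int Int_assoc by blast
qed

lemma dim_Int_hyperplane:
  fixes h :: "'a::euclidean_space"
  assumes "subspace U" "\<not> U \<subseteq> {x. h \<bullet> x = 0}"
  shows "dim U = Suc (dim (U \<inter> {x. h \<bullet> x = 0}))"
proof -
  have s: "subspace (U \<inter> {x. h \<bullet> x = 0})"
    using assms by (simp add: subspace_inter subspace_hyperplane)
  have "0 \<in> U \<inter> {x. h \<bullet> x = 0}" using s subspace_0 by blast
  then have "aff_dim (U \<inter> {x. h \<bullet> x = 0}) = aff_dim U - 1"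
    using assms(2) aff_dim_affine_Int_hyperplane[OF subspace_imp_affine[OF assms(1)], of h 0] by auto
  then show ?thesis using assms s by (simp add: aff_dim_subspace)
qed

lemma sum_Pow_insert:
  fixes g :: "'a set \<Rightarrow> 'b::comm_monoid_add"
  assumes "finite V" "h \<notin> V"
  shows "sum g (Pow (insert h V)) = (\<Sum>B\<in>Pow V. g B + g (insert h B))"
proof -
  have "sum g (Pow (insert h V)) = sum g (Pow V) + sum g (insert h ` Pow V)"
    unfolding Pow_insert using assms by (intro sum.union_disjoint) auto
  also have "sum g (insert h ` Pow V) = (\<Sum>B\<in>Pow V. g (insert h B))"
    using assms by (intro sum.reindex_cong[OF _ refl refl]) (auto simp: inj_on_def)
  finally show ?thesis by (simp add: sum.distrib)
qed

lemma orthogonal_comp_insert: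
  "orthogonal_comp (insert h B) = {x. h \<bullet> x = 0} \<inter> orthogonal_comp B"
  by (auto simp: orthogonal_comp_def orthogonal_def)

text \<open>Induction on \<open>V\<close> with \<open>U\<close> general: for a new \<open>h\<close>,
  deletion keeps \<open>U\<close> and restriction replaces it by its slice. Modulo 2 the exponent is
  \<open>card B\<close> plus the codimension in \<open>U\<close> of the flat.\<close>

theorem sum_proj_value_cells:
  fixes V :: "'a::euclidean_space set"
  assumes "finite V" "subspace U"
  shows "(\<Sum>P\<in>Pow V. proj_value f y (cell V U P)) =
    (\<Sum>B\<in>Pow V. (-1) ^ (card B + dim U + dim (U \<inter> orthogonal_comp B)) *
        f (closest_point (U \<inter> orthogonal_comp B) y))"
  using assms
proof (induction V arbitrary: U rule: finite_induct)
  case empty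
  then have "U \<noteq> {}" "closed U" using subspace_0 closed_subspace by auto
  then show ?case by (simp add: proj_value_def cell_def orthogonal_comp_def flip: power_add mult_2)
next
  case (insert h V)
  let ?H = "{x. h \<bullet> x = 0}"
  let ?g = "\<lambda>U B. (-1) ^ (card B + dim U + dim (U \<inter> orthogonal_comp B)) *
        f (closest_point (U \<inter> orthogonal_comp B) y)"
  have c1: "cell (insert h V) U P = cell V U P \<inter> {x. h \<bullet> x < 0}"
       "cell (insert h V) U (insert h P) = cell V U P \<inter> {x. h \<bullet> x > 0}"
       "cell V (U \<inter> ?H) P = cell V U P \<inter> ?H" if "P \<in> Pow V" for P
    using that insert.hyps(2) by (auto simp: cell_def)
  show ?case
  proof (cases "U \<subseteq> ?H")
    \<comment> \<open>When \<open>h\<close> vanishes on \<open>U\<close>, no cell can be nonempty,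
      and on the right \<open>B\<close> and \<open>insert h B\<close> give the same flat with
      opposite signs.\<close>
    case True
    have "cell (insert h V) U P = {}" if "P \<subseteq> insert h V" for P
      using True unfolding cell_def by (cases "h \<in> P") force+
    then have L: "(\<Sum>P\<in>Pow (insert h V). proj_value f y (cell (insert h V) U P)) = 0"
      by (simp add: proj_value_def)
    have "?g U (insert h B) = - ?g U B" if "B \<in> Pow V" for B
    proof -
      have "finite B" "h \<notin> B" using that insert.hyps finite_subset by auto
      moreover have "U \<inter> orthogonal_comp (insert h B) = U \<inter> orthogonal_comp B"
        using True by (auto simp: orthogonal_comp_insert)
      ultimately show ?thesis by simp
    qed
    then have "sum (?g U) (Pow (insert h V)) = 0"
      by (simp add: sum_Pow_insert insert.hyps)
    with L show ?thesis by simp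
  next
    case False
    have "subspace (U \<inter> ?H)" using insert.prems by (simp add: subspace_inter subspace_hyperplane)
    note IH = insert.IH[OF insert.prems] insert.IH[OF this]
    \<comment> \<open>The left side has one more vector, and \<open>U\<close> has one more dimension
      than its slice, so the exponents differ by 2.\<close>
    have "?g U (insert h B) = ?g (U \<inter> ?H) B" if "B \<in> Pow V" for B
    proof -
      have "finite B" "h \<notin> B" using that insert.hyps finite_subset by auto
      moreover have "U \<inter> orthogonal_comp (insert h B) = U \<inter> ?H \<inter> orthogonal_comp B"
        by (auto simp: orthogonal_comp_insert)
      ultimately show ?thesis using dim_Int_hyperplane[OF insert.prems False] by simp
    qed
    then have "sum (?g U) (Pow (insert h V)) = sum (?g U) (Pow V) + sum (?g (U \<inter> ?H)) (Pow V)"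
      by (simp add: sum_Pow_insert insert.hyps sum.distrib)
    also have "\<dots> = (\<Sum>P\<in>Pow V. proj_value f y (cell V U P) + proj_value f y (cell V (U \<inter> ?H) P))"
      by (simp add: sum.distrib IH)
    also have "\<dots> = (\<Sum>P\<in>Pow V. proj_value f y (cell (insert h V) U P)
        + proj_value f y (cell (insert h V) U (insert h P)))"
    proof (rule sum.cong[OF refl])
      fix P assume P: "P \<in> Pow V"
      show "proj_value f y (cell V U P) + proj_value f y (cell V (U \<inter> ?H) P) =
         proj_value f y (cell (insert h V) U P) + proj_value f y (cell (insert h V) U (insert h P))"
        unfolding c1[OF P] using P insert
        by (intro proj_value_split[symmetric, OF _ openin_cell _ False] convex_cell
            subspace_imp_convex) auto
    qed
    also have "\<dots> = (\<Sum>P\<in>Pow (insert h V). proj_value f y (cell (insert h V) U P))"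
      by (simp add: sum_Pow_insert insert.hyps)
    finally show ?thesis by simp
  qed
qed

section \<open>Whitney's formula\<close>

text \<open>Inserting a fixed element pairs off subsets of opposite parity.\<close>

lemma sum_alternating_Pow:
  assumes "finite V"
  shows "(\<Sum>B\<in>Pow V. (-1) ^ card B :: 'b::comm_ring_1) = (if V = {} then 1 else 0)"
  using assms
proof (cases rule: finite.cases)
  case (insertI A a)
  then have "finite (A - {a})" "V = insert a (A - {a})" by auto
  moreover have "(-1) ^ card (insert a B) = - ((-1) ^ card B :: 'b)" if "B \<in> Pow (A - {a})" for B
  proof -
    have "finite B" "a \<notin> B" using that insertI finite_subset by auto
    then show ?thesis by simp
  qed
  ultimately show ?thesis
    using sum_Pow_insert[of "A - {a}" a "\<lambda>B. (-1) ^ card B :: 'b"] by simp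
qed simp

lemma orthogonal_comp_eq_UNIV_iff:
  fixes B :: "'a::euclidean_space set"
  assumes "0 \<notin> B"
  shows "orthogonal_comp B = UNIV \<longleftrightarrow> B = {}"
proof
  assume "orthogonal_comp B = UNIV"
  then have "b \<bullet> b = 0" if "b \<in> B" for b
    using that by (auto simp: orthogonal_comp_def orthogonal_def simp del: inner_eq_zero_iff)
  then show "B = {}" using assms by auto
qed (simp add: orthogonal_comp_def)

text \<open>The right-hand side obeys the recursion defining \<open>mobius\<close>: summed over all
  flats containing \<open>y\<close>, it runs over all sets of vectors of \<open>V\<close> orthogonal
  to \<open>y\<close>, and this alternating sum vanishes once such a vector exists.\<close>

theorem mobius_eq_alternating_sum:
  fixes V :: "'a::euclidean_space set"
  assumes V: "finite V" "0 \<notin> V"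
  defines "L \<equiv> orthogonal_comp ` Pow V"
  assumes "y \<in> L"
  shows "mobius L y = (\<Sum>B | B \<subseteq> V \<and> orthogonal_comp B = y. (-1) ^ card B)"
  using \<open>y \<in> L\<close>
proof (induction "card {z \<in> L. y \<subset> z}" arbitrary: y rule: less_induct)
  case less
  have L: "finite L" using V by (simp add: L_def)
  have IH: "mobius L z = (\<Sum>B | B \<subseteq> V \<and> orthogonal_comp B = z. (-1) ^ card B)"
    if "z \<in> L" "y \<subset> z" for z
  proof (rule less.hyps[OF _ that(1)])
    show "card {w \<in> L. z \<subset> w} < card {w \<in> L. y \<subset> w}"
      using that L by (intro psubset_card_mono) auto
  qed
  show ?case
  proof (cases "y = UNIV")
    case True
    \<comment> \<open>As 0 is not in \<open>V\<close>, only the empty set cuts out the whole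
      space.\<close>
    have "{B. B \<subseteq> V \<and> orthogonal_comp B = y} = {{}}"
      using orthogonal_comp_eq_UNIV_iff[of "_ :: 'a set"] V(2) True by auto
    then show ?thesis using L True by (simp add: mobius_UNIV)
  next
    case False
    obtain B0 where B0: "B0 \<subseteq> V" "y = orthogonal_comp B0" using less.prems L_def by auto
    have B0_ne: "B0 \<noteq> {}" using False B0 V(2) orthogonal_comp_eq_UNIV_iff by blast
    let ?Vy = "{v \<in> V. \<forall>x\<in>y. v \<bullet> x = 0}"
    have "?Vy \<noteq> {}" using B0 B0_ne by (auto simp: orthogonal_comp_def orthogonal_def)
    then have "0 = (\<Sum>B\<in>Pow ?Vy. (-1) ^ card B :: int)"
      using V(1) by (simp add: sum_alternating_Pow)
    also have "Pow ?Vy = {B. B \<subseteq> V \<and> y \<subseteq> orthogonal_comp B}"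
      by (auto simp: orthogonal_comp_def orthogonal_def)
    also have "(\<Sum>B | B \<subseteq> V \<and> y \<subseteq> orthogonal_comp B. (-1) ^ card B)
       = (\<Sum>z | z \<in> L \<and> y \<subseteq> z. \<Sum>B | B \<subseteq> V \<and> orthogonal_comp B = z. (-1) ^ card B :: int)"
    proof -
      have "(\<Sum>z | z \<in> L \<and> y \<subseteq> z. \<Sum>B | B \<subseteq> V \<and> orthogonal_comp B = z. (-1) ^ card B :: int)
         = (\<Sum>z | z \<in> L \<and> y \<subseteq> z.
              \<Sum>B \<in> {B \<in> {B. B \<subseteq> V \<and> y \<subseteq> orthogonal_comp B}. orthogonal_comp B = z}. (-1) ^ card B)"
        by (intro sum.cong) auto
      then show ?thesis
        using L V by (subst (asm) sum.group) (auto simp: L_def)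
    qed
    also have "{z. z \<in> L \<and> y \<subseteq> z} = insert y {z. z \<in> L \<and> y \<subset> z}"
      using less.prems by auto
    finally have "(\<Sum>B | B \<subseteq> V \<and> orthogonal_comp B = y. (-1) ^ card B)
       = - (\<Sum>z | z \<in> L \<and> y \<subset> z. \<Sum>B | B \<subseteq> V \<and> orthogonal_comp B = z. (-1) ^ card B :: int)"
      using L by simp
    also have "\<dots> = - (\<Sum>z | z \<in> L \<and> y \<subset> z. mobius L z)"
      using IH by simp
    finally show ?thesis using L False by (simp add: mobius.simps[of L y])
  qed
qed

lemma intersection_lattice_hyperplanes:
  "intersection_lattice ((\<lambda>a. {x. a \<bullet> x = 0}) ` V) = orthogonal_comp ` Pow V"
proof -
  have "\<Inter> ((\<lambda>a. {x. a \<bullet> x = 0}) ` B) = orthogonal_comp B" for B :: "'a set"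
    by (auto simp: orthogonal_comp_def orthogonal_def)
  then show ?thesis
    unfolding intersection_lattice_def subset_image_iff
    by auto
qed

text \<open>Subsets are grouped by the flat they cut out, and each group sums to the Moebius value
  of its flat. Several normals of one hyperplane may occur in \<open>V\<close>.\<close>

theorem coeff_characteristic_poly_hyperplanes:
  fixes V :: "'a::euclidean_space set"
  assumes V: "finite V" "0 \<notin> V"
  shows "coeff (characteristic_poly ((\<lambda>a. {x. a \<bullet> x = 0}) ` V)) k
    = (\<Sum>B | B \<subseteq> V \<and> dim (orthogonal_comp B) = k. (-1) ^ card B)"
proof -
  let ?L = "orthogonal_comp ` Pow V"
  have "coeff (characteristic_poly ((\<lambda>a. {x. a \<bullet> x = 0}) ` V)) k
     = (\<Sum>y\<in>?L. if dim y = k then mobius ?L y else 0)"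
    unfolding characteristic_poly_def intersection_lattice_hyperplanes
    by (simp add: coeff_sum)
  also have "\<dots> = (\<Sum>y | y \<in> ?L \<and> dim y = k. mobius ?L y)"
    using V by (simp add: sum.inter_filter)
  also have "\<dots> = (\<Sum>y | y \<in> ?L \<and> dim y = k.
      \<Sum>B \<in> {B \<in> {B. B \<subseteq> V \<and> dim (orthogonal_comp B) = k}. orthogonal_comp B = y}. (-1) ^ card B)"
    using V by (intro sum.cong) (auto simp: mobius_eq_alternating_sum intro!: sum.cong)
  also have "\<dots> = (\<Sum>B | B \<subseteq> V \<and> dim (orthogonal_comp B) = k. (-1) ^ card B)"
    using V by (intro sum.group) auto
  finally show ?thesis .
qed

section \<open>Chambers and their faces\<close>

text \<open>On a connected set avoiding the hyperplanes no normal changes sign, so such a set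
  containing the cell cannot be larger.\<close>

lemma cell_component:
  fixes V :: "'a::euclidean_space set"
  assumes P: "P \<subseteq> V" and ne: "cell V UNIV P \<noteq> {}"
  shows "cell V UNIV P \<in> components (- \<Union> ((\<lambda>a. {x. a \<bullet> x = 0}) ` V))"
proof -
  have "D = cell V UNIV P"
    if D: "cell V UNIV P \<subseteq> D" "D \<subseteq> - \<Union> ((\<lambda>a. {x. a \<bullet> x = 0}) ` V)" "connected D" for D
  proof (intro equalityI D(1) subsetI)
    fix x assume x: "x \<in> D"
    obtain p where p: "p \<in> cell V UNIV P" using ne by blast
    have nz: "a \<bullet> z \<noteq> 0" if "a \<in> V" "z \<in> D" for a z using D(2) that by auto
    have "p \<in> D" using p D(1) by blast
    then have same_sign: "a \<bullet> x > 0 \<longleftrightarrow> a \<bullet> p > 0" if "a \<in> V" for a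
      using connected_ivt_hyperplane[OF D(3), of x p a 0] connected_ivt_hyperplane[OF D(3), of p x a 0]
        nz[OF that] x by (metis linorder_not_le order_less_imp_le)
    have "a \<bullet> x < 0" if "a \<in> V - P" for a
    proof -
      have "a \<bullet> p < 0" "a \<bullet> x \<noteq> 0" using p nz x that by (auto simp: cell_def)
      then show ?thesis using same_sign[of a] that by auto
    qed
    then show "x \<in> cell V UNIV P"
      using same_sign p P by (auto simp: cell_def)
  qed
  moreover have "connected (cell V UNIV P)"
    by (simp add: convex_connected convex_cell)
  moreover have "cell V UNIV P \<subseteq> - \<Union> ((\<lambda>a. {x. a \<bullet> x = 0}) ` V)"
    using P by (force simp: cell_def)
  ultimately show ?thesis
    using ne by (auto simp: in_components_maximal)
qed

lemma mem_cell_positive_set: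
  assumes "\<forall>a\<in>V. a \<bullet> x \<noteq> 0"
  shows "x \<in> cell V UNIV {a \<in> V. a \<bullet> x > 0}"
proof -
  have "a \<bullet> x < 0" if "a \<in> V" "\<not> a \<bullet> x > 0" for a
    using assms that by (meson linorder_neqE)
  then show ?thesis by (auto simp: cell_def)
qed

text \<open>\<open>P\<close> can be read off from any point of its cell as the set of normals
  positive there, and every point off the hyperplanes lies in the cell so determined.\<close>

lemma bij_betw_cells_components:
  fixes V :: "'a::euclidean_space set"
  shows "bij_betw (cell V UNIV) {P. P \<subseteq> V \<and> cell V UNIV P \<noteq> {}}
     (components (- \<Union> ((\<lambda>a. {x. a \<bullet> x = 0}) ` V)))" (is "bij_betw _ _ (components ?X)")
proof (rule bij_betwI')
  fix P Q assume PQ: "P \<in> {P. P \<subseteq> V \<and> cell V UNIV P \<noteq> {}}" "Q \<in> {P. P \<subseteq> V \<and> cell V UNIV P \<noteq> {}}"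
  have *: "P = {a \<in> V. a \<bullet> x > 0}" if "x \<in> cell V UNIV P" "P \<subseteq> V" for x P
  proof -
    have "\<not> a \<bullet> x > 0" if "a \<in> V - P" for a
      using that \<open>x \<in> cell V UNIV P\<close> by (auto simp: cell_def dest: order.asym)
    then show ?thesis using that by (auto simp: cell_def)
  qed
  obtain x where "x \<in> cell V UNIV P" using PQ by blast
  then show "cell V UNIV P = cell V UNIV Q \<longleftrightarrow> P = Q"
    using PQ *[of x P] *[of x Q] by auto
next
  fix R assume R: "R \<in> components ?X"
  then obtain x where x: "x \<in> R" using in_components_nonempty by blast
  then have "\<forall>a\<in>V. a \<bullet> x \<noteq> 0" using in_components_subset[OF R] by auto
  then have *: "x \<in> cell V UNIV {a \<in> V. a \<bullet> x > 0}" by (rule mem_cell_positive_set)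
  then have "cell V UNIV {a \<in> V. a \<bullet> x > 0} \<in> components ?X"
    by (intro cell_component) auto
  then have "R = cell V UNIV {a \<in> V. a \<bullet> x > 0}"
    using components_eq[OF R] x * by blast
  then show "\<exists>P\<in>{P. P \<subseteq> V \<and> cell V UNIV P \<noteq> {}}. R = cell V UNIV P"
    using * by blast
qed (use cell_component in auto)

lemma closure_cell:
  fixes V :: "'a::euclidean_space set"
  assumes P: "P \<subseteq> V" and ne: "cell V UNIV P \<noteq> {}"
  shows "closure (cell V UNIV P) = {x. (\<forall>a\<in>P. a \<bullet> x \<ge> 0) \<and> (\<forall>a\<in>V - P. a \<bullet> x \<le> 0)}" (is "_ = ?C")
proof
  have "?C = (\<Inter>a\<in>P. {x. a \<bullet> x \<ge> 0}) \<inter> (\<Inter>a\<in>V - P. {x. a \<bullet> x \<le> 0})" by auto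
  also have "closed \<dots>"
    by (intro closed_Int closed_INT) (auto simp: closed_halfspace_ge closed_halfspace_le)
  finally show "closure (cell V UNIV P) \<subseteq> ?C"
    by (intro closure_minimal) (auto simp: cell_def order.strict_implies_order)
  obtain q where q: "q \<in> cell V UNIV P" using ne by blast
  show "?C \<subseteq> closure (cell V UNIV P)"
  proof
    fix x assume x: "x \<in> ?C"
    \<comment> \<open>Adding a small positive multiple of a strict solution \<open>q\<close> makes
      every weak inequality strict.\<close>
    have "(\<lambda>n. x + (1 / real (Suc n)) *\<^sub>R q) \<longlonglongrightarrow> x + 0 *\<^sub>R q"
      using LIMSEQ_Suc[OF lim_1_over_n] by (intro tendsto_intros) auto
    then have "(\<lambda>n. x + (1 / real (Suc n)) *\<^sub>R q) \<longlonglongrightarrow> x" by simp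
    moreover have "x + (1 / real (Suc n)) *\<^sub>R q \<in> cell V UNIV P" for n
      using x q by (auto simp: cell_def inner_add_right divide_neg_pos intro!: add_nonneg_pos add_nonpos_neg)
    ultimately show "x \<in> closure (cell V UNIV P)"
      unfolding closure_sequential by (intro exI[of _ "\<lambda>n. x + (1 / real (Suc n)) *\<^sub>R q"]) auto
  qed
qed

section \<open>Minimal flats and faces of closed chambers\<close>

text \<open>The smallest flat through \<open>x\<close>. For \<open>x\<close> in a closed chamber it
  is the affine hull of the face with \<open>x\<close> in its relative interior.\<close>

definition min_flat :: "'a::euclidean_space set \<Rightarrow> 'a \<Rightarrow> 'a set"
  where "min_flat V x = orthogonal_comp {a \<in> V. a \<bullet> x = 0}"

lemma subspace_min_flat: "subspace (min_flat V x)"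
  by (simp add: min_flat_def subspace_orthogonal_comp)

text \<open>The face \<open>?C \<inter> ?M\<close> has affine hull \<open>?M\<close> and
  \<open>x\<close> in its relative interior. Faces whose relative interiors meet coincide, so no
  other face can decide the dimension.\<close>

lemma k_dimensional_iff_dim_min_flat:
  fixes V :: "'a::euclidean_space set"
  assumes V: "finite V" and P: "P \<subseteq> V" and ne: "cell V UNIV P \<noteq> {}"
    and x: "x \<in> closure (cell V UNIV P)"
  shows "k_dimensional (closure (cell V UNIV P)) k x \<longleftrightarrow> dim (min_flat V x) = k"
proof -
  let ?C = "closure (cell V UNIV P)" and ?M = "min_flat V x"
  note C = closure_cell[OF P ne]
  have M: "affine ?M" "x \<in> ?M"
    using subspace_imp_affine[OF subspace_min_flat]
    by (auto simp: min_flat_def orthogonal_comp_def orthogonal_def)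
  have face: "?C \<inter> ?M face_of ?C"
    unfolding face_of_def
  proof (intro conjI ballI impI)
    show "convex (?C \<inter> ?M)"
      by (simp add: convex_Int convex_closure convex_cell affine_imp_convex M)
    fix p q z assume p: "p \<in> ?C" and q: "q \<in> ?C" and z: "z \<in> ?C \<inter> ?M" "z \<in> open_segment p q"
    obtain u where u: "0 < u" "u < 1" "z = (1 - u) *\<^sub>R p + u *\<^sub>R q"
      using z(2) by (auto simp: in_segment)
    have "a \<bullet> p = 0 \<and> a \<bullet> q = 0" if a: "a \<in> V" "a \<bullet> x = 0" for a
    proof -
      have "a \<bullet> z = 0" using z a by (auto simp: min_flat_def orthogonal_comp_def orthogonal_def)
      then have sum0: "(1 - u) * (a \<bullet> p) + u * (a \<bullet> q) = 0"
        unfolding u by (simp add: inner_add_right)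
      \<comment> \<open>A normal keeps a weak sign on a closed chamber, so the two terms of
        \<open>sum0\<close> cannot cancel and both vanish.\<close>
      have "a \<bullet> p \<ge> 0 \<and> a \<bullet> q \<ge> 0 \<or> a \<bullet> p \<le> 0 \<and> a \<bullet> q \<le> 0"
        using p q a(1) unfolding C by blast
      then have "(1 - u) * (a \<bullet> p) = 0 \<and> u * (a \<bullet> q) = 0"
      proof
        assume "a \<bullet> p \<ge> 0 \<and> a \<bullet> q \<ge> 0"
        then have "(1 - u) * (a \<bullet> p) \<ge> 0" "u * (a \<bullet> q) \<ge> 0" using u by auto
        then show ?thesis using sum0 by linarith
      next
        assume "a \<bullet> p \<le> 0 \<and> a \<bullet> q \<le> 0"
        then have "(1 - u) * (a \<bullet> p) \<le> 0" "u * (a \<bullet> q) \<le> 0"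
          using u by (auto intro: mult_nonneg_nonpos)
        then show ?thesis using sum0 by linarith
      qed
      then show ?thesis using u by simp
    qed
    then show "p \<in> ?C \<inter> ?M" "q \<in> ?C \<inter> ?M"
      using p q by (auto simp: min_flat_def orthogonal_comp_def orthogonal_def)
  qed simp
  \<comment> \<open>On \<open>U\<close> the normals that are nonzero at \<open>x\<close> keep their
    signs, and on \<open>?M\<close> the others vanish. So a neighbourhood of \<open>x\<close> in
    \<open>?M\<close> lies in \<open>?C\<close>.\<close>
  define U where "U = (\<Inter>a\<in>{a \<in> V. a \<bullet> x > 0}. {z. a \<bullet> z > 0}) \<inter> (\<Inter>a\<in>{a \<in> V. a \<bullet> x < 0}. {z. a \<bullet> z < 0})"
  have U: "open U" "x \<in> U" "U \<inter> ?M \<subseteq> ?C"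
  proof -
    show "open U" unfolding U_def using V
      by (intro open_Int open_INT) (auto simp: open_halfspace_gt open_halfspace_lt)
    show "x \<in> U" by (auto simp: U_def)
    show "U \<inter> ?M \<subseteq> ?C"
    proof
      fix z assume z: "z \<in> U \<inter> ?M"
      have "sgn (a \<bullet> z) = sgn (a \<bullet> x)" if "a \<in> V" for a
        using z that by (cases "a \<bullet> x" "0::real" rule: linorder_cases)
          (auto simp: U_def min_flat_def orthogonal_comp_def orthogonal_def)
      then show "z \<in> ?C" using x P unfolding C
        by (smt (verit, ccfv_SIG) Diff_iff mem_Collect_eq sgn_less sgn_greater subset_iff)
    qed
  qed
  have "openin (top_of_set ?M) (U \<inter> ?M)"
    using openin_open_Int[OF U(1), of ?M] by (simp add: Int_commute)
  then have "affine hull (U \<inter> ?M) = ?M"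
    using U M by (metis IntI affine_hull_openin emptyE hull_same)
  then have hull: "affine hull (?C \<inter> ?M) = ?M"
    using hull_mono[of "U \<inter> ?M" "?C \<inter> ?M" affine] hull_mono[of "?C \<inter> ?M" ?M affine]
      hull_same[of affine ?M] U(3) M by auto
  then have rel: "x \<in> rel_interior (?C \<inter> ?M)"
    unfolding mem_rel_interior hull using U x M by (intro exI[of _ U]) auto
  have "aff_dim (?C \<inter> ?M) = dim ?M"
    using hull aff_dim_affine_hull[of "?C \<inter> ?M"] aff_dim_subspace[OF subspace_min_flat, of V x] by simp
  then show ?thesis
    unfolding k_dimensional_def using face rel face_of_eq[OF _ face] by fastforce
qed

section \<open>Projections of generic points to flats\<close>

lemma subspace_closest_point_orthogonal:
  fixes M :: "'a::euclidean_space set"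
  assumes M: "subspace M" and m: "m \<in> M"
  shows "(y - closest_point M y) \<bullet> m = 0"
proof -
  have cl: "convex M" "closed M" "M \<noteq> {}"
    using M subspace_imp_convex closed_subspace subspace_0 by blast+
  then have "closest_point M y \<in> M" by (simp add: closest_point_in_set)
  then have "closest_point M y + m \<in> M" "closest_point M y - m \<in> M"
    using M m by (auto simp: subspace_add subspace_diff)
  \<comment> \<open>The variational inequality at these two points bounds the inner product from
    both sides by 0.\<close>
  from this[THEN closest_point_dot[OF cl(1,2), of _ y]] show ?thesis by simp
qed

text \<open>Projection to \<open>M\<close> is self-adjoint, so
  \<open>a \<bullet> ?p y = ?p a \<bullet> y\<close>, and \<open>?p a\<close> is nonzero because
  \<open>a\<close> does not vanish on \<open>M\<close>. The set is therefore a hyperplane.\<close>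

lemma negligible_closest_point_hyperplane:
  fixes M :: "'a::euclidean_space set"
  assumes M: "subspace M" and a: "\<not> M \<subseteq> {x. a \<bullet> x = 0}"
  shows "negligible {y. a \<bullet> closest_point M y = 0}"
proof -
  let ?p = "closest_point M"
  have p: "?p y \<in> M" for y
    using M closed_subspace subspace_0 closest_point_in_set by blast
  have *: "a \<bullet> m = ?p a \<bullet> m" if "m \<in> M" for m
    using subspace_closest_point_orthogonal[OF M that, of a] by (simp add: inner_diff_left)
  have "a \<bullet> ?p y = ?p a \<bullet> y" for y
    using *[OF p, of y] subspace_closest_point_orthogonal[OF M p, of y a]
    by (simp add: inner_diff_right inner_commute[of _ "?p a"])
  moreover have "?p a \<noteq> 0" using a * by auto
  ultimately show ?thesis using negligible_hyperplane[of "?p a" 0] by simp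
qed

text \<open>The minimal flat can be smaller than the flat of \<open>B\<close> only if a normal that
  does not vanish on that flat vanishes at the projection. Each of the finitely many pairs costs a
  null set.\<close>

lemma AE_min_flat_closest_point:
  fixes V :: "'a::euclidean_space set"
  assumes V: "finite V"
  shows "AE y in lebesgue. \<forall>B\<subseteq>V. min_flat V (closest_point (orthogonal_comp B) y) = orthogonal_comp B"
proof -
  define D where "D = {(B, a). B \<subseteq> V \<and> a \<in> V \<and> \<not> orthogonal_comp B \<subseteq> {x. a \<bullet> x = 0}}"
  define N where "N = (\<Union>(B, a)\<in>D. {y. a \<bullet> closest_point (orthogonal_comp B) y = 0})"
  have "finite D"
    by (rule finite_subset[of _ "Pow V \<times> V"]) (use V in \<open>auto simp: D_def\<close>)
  then have "negligible N"
    unfolding N_def D_def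
    by (intro negligible_Union) (auto intro: negligible_closest_point_hyperplane subspace_orthogonal_comp)
  then have "AE y in lebesgue. y \<notin> N"
    by (simp add: AE_not_in negligible_iff_null_sets)
  then show ?thesis
  proof (rule AE_mp, intro AE_I2 impI allI)
    fix y B assume y: "y \<notin> N" and B: "B \<subseteq> V"
    let ?x = "closest_point (orthogonal_comp B) y"
    have x: "?x \<in> orthogonal_comp B"
      by (metis closed_subspace closest_point_in_set empty_iff subspace_0 subspace_orthogonal_comp)
    have "orthogonal_comp B \<subseteq> {z. a \<bullet> z = 0}" if "a \<in> V" "a \<bullet> ?x = 0" for a
      using y B that by (auto simp: N_def D_def)
    then show "min_flat V ?x = orthogonal_comp B"
      using x B unfolding min_flat_def orthogonal_comp_def orthogonal_def
      by blast
  qed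
qed

text \<open>The sum over cells is applied to the indicator of points with a
  \<open>k\<close>-dimensional minimal flat. For generic \<open>y\<close> only subsets with a
  \<open>k\<close>-dimensional flat survive, so the count is the coefficient up to the common sign
  \<open>(-1) ^ (DIM('a) + k)\<close>; being nonnegative, it is the absolute value.\<close>

theorem card_chambers_dim_min_flat:
  fixes V :: "'a::euclidean_space set"
  assumes V: "finite V" "0 \<notin> V"
    and y: "\<forall>B\<subseteq>V. min_flat V (closest_point (orthogonal_comp B) y) = orthogonal_comp B"
  shows "real (card {R \<in> components (- \<Union> ((\<lambda>a. {x. a \<bullet> x = 0}) ` V)).
            dim (min_flat V (closest_point (closure R) y)) = k})
      = \<bar>of_int (coeff (characteristic_poly ((\<lambda>a. {x. a \<bullet> x = 0}) ` V)) k)\<bar>"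
    (is "real (card {R \<in> components ?X. _ R}) = \<bar>of_int (coeff ?\<chi> k)\<bar>")
proof -
  define f :: "'a \<Rightarrow> real" where "f x = (if dim (min_flat V x) = k then 1 else 0)" for x
  let ?S = "{P. P \<subseteq> V \<and> cell V UNIV P \<noteq> {}}"
  have fin: "finite (components ?X)"
    using bij_betw_finite[OF bij_betw_cells_components[of V]] V(1) by simp
  have "real (card {R \<in> components ?X. dim (min_flat V (closest_point (closure R) y)) = k})
     = (\<Sum>R\<in>components ?X. f (closest_point (closure R) y))"
    using fin by (simp add: f_def sum.If_cases Int_def)
  also have "\<dots> = (\<Sum>P\<in>?S. f (closest_point (closure (cell V UNIV P)) y))"
    by (rule sum.reindex_bij_betw[OF bij_betw_cells_components[of V], symmetric])
  also have "\<dots> = (\<Sum>P\<in>Pow V. proj_value f y (cell V UNIV P))"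
    using V(1) by (intro sum.mono_neutral_cong_left) (auto simp: proj_value_def)
  also have "\<dots> = (\<Sum>B\<in>Pow V. (-1) ^ (card B + DIM('a) + dim (orthogonal_comp B)) *
        f (closest_point (orthogonal_comp B) y))"
    using sum_proj_value_cells[OF V(1) subspace_UNIV] by simp
  also have "\<dots> = (\<Sum>B | B \<subseteq> V \<and> dim (orthogonal_comp B) = k. (-1) ^ (DIM('a) + k) * (-1) ^ card B)"
    using V(1) y by (intro sum.mono_neutral_cong_right) (auto simp: f_def power_add)
  also have "\<dots> = (-1) ^ (DIM('a) + k) * of_int (coeff ?\<chi> k)"
    by (simp add: coeff_characteristic_poly_hyperplanes[OF V] sum_distrib_left)
  finally have *: "real (card {R \<in> components ?X. dim (min_flat V (closest_point (closure R) y)) = k})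
     = (-1) ^ (DIM('a) + k) * of_int (coeff ?\<chi> k)" .
  show ?thesis
    by (subst abs_of_nonneg[OF of_nat_0_le_iff, symmetric], subst *) (simp add: abs_mult)
qed

section \<open>Projection volumes of all chambers\<close>

text \<open>The factor \<open>c\<close> lets this serve both for dilations of a cone and for
  orthogonal maps, where \<open>c = 1\<close>.\<close>

lemma closest_point_similarity:
  fixes f :: "'a::euclidean_space \<Rightarrow> 'a"
  assumes f: "linear f" "\<And>x. norm (f x) = c * norm x" "c > 0"
    and C: "closed C" "convex C" "C \<noteq> {}"
  shows "closest_point (f ` C) (f y) = f (closest_point C y)"
proof -
  have dist: "dist (f x) (f z) = c * dist x z" for x z
    using f(1,2) by (metis dist_norm linear_diff)
  have "inj f" using dist f(3) by (metis dist_eq_0_iff injI less_numeral_extra(3) mult_eq_0_iff)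
  then have cl: "closed (f ` C)" "convex (f ` C)"
    using f C by (auto simp: closed_injective_linear_image convex_linear_image)
  have "f (closest_point C y) \<in> f ` C" using C by (simp add: closest_point_in_set)
  moreover have "\<forall>z\<in>f ` C. dist (f y) (f (closest_point C y)) \<le> dist (f y) z"
    using C(1) f(3) by (auto simp: dist closest_point_le)
  ultimately show ?thesis
    using closest_point_unique[OF cl(2,1)] by metis
qed

lemma k_dimensional_linear_image:
  fixes f :: "'a::euclidean_space \<Rightarrow> 'a"
  assumes f: "linear f" "inj f"
  shows "k_dimensional (f ` C) k (f x) \<longleftrightarrow> k_dimensional C k x"
proof -
  have rel: "rel_interior (f ` F) = f ` rel_interior F" for F
    using f by (simp add: rel_interior_injective_linear_image linear_conv_bounded_linear)
  have "k_dimensional (f ` C) k (f x) \<longleftrightarrow>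
      (\<exists>F. f ` F face_of f ` C \<and> aff_dim (f ` F) = int k \<and> f x \<in> rel_interior (f ` F))"
    \<comment> \<open>A face of the image is a subset of the image, hence itself the image of some
      \<open>F\<close>.\<close>
    unfolding k_dimensional_def by (metis face_of_imp_subset subset_imageE)
  then show ?thesis
    using f by (simp add: k_dimensional_def face_of_linear_image rel inj_image_mem_iff)
qed

text \<open>For a cone, the solid region measured by \<open>sphere_volume\<close>; the origin is
  left out because the radial parameter there is positive.\<close>

definition shadow :: "'a::euclidean_space set \<Rightarrow> nat \<Rightarrow> 'a set"
  where "shadow C k = {y \<in> cball 0 1 - {0}. k_dimensional C k (closest_point C y)}"

text \<open>Projection to a cone commutes with dilations, so the dimension test is constant along
  open rays. The factor \<open>DIM('a)\<close> cancels in the quotient.\<close>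

lemma projection_volume_eq_shadow:
  fixes C :: "'a::euclidean_space set"
  assumes C: "closed C" "convex C" "C \<noteq> {}" and cone: "\<And>t. t > 0 \<Longrightarrow> (*\<^sub>R) t ` C = C"
  shows "projection_volume C k = measure lebesgue (shadow C k) / measure lebesgue (cball 0 1 :: 'a set)"
proof -
  have kd: "k_dimensional C k (closest_point C (t *\<^sub>R y)) \<longleftrightarrow> k_dimensional C k (closest_point C y)"
    if "t > 0" for t y
  proof -
    have lin: "linear ((*\<^sub>R) t :: 'a \<Rightarrow> 'a)" by simp
    have inj: "inj ((*\<^sub>R) t :: 'a \<Rightarrow> 'a)" using that by (simp add: injective_scaleR)
    have "norm (t *\<^sub>R x) = t * norm x" for x :: 'a using that by simp
    from closest_point_similarity[OF lin this that C, of y]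
    show ?thesis
      using k_dimensional_linear_image[OF lin inj, of C k "closest_point C y"] cone[OF that] by simp
  qed
  have "{t *\<^sub>R y | t y. 0 < t \<and> t \<le> 1 \<and> y \<in> {y \<in> sphere 0 1. k_dimensional C k (closest_point C y)}}
      = shadow C k" (is "?L = _")
  proof (intro equalityI subsetI)
    fix x assume x: "x \<in> shadow C k"
    then have "k_dimensional C k (closest_point C (x /\<^sub>R norm x))"
      using kd[of "inverse (norm x)" x] by (simp add: shadow_def)
    moreover have "x = norm x *\<^sub>R (x /\<^sub>R norm x) \<and> 0 < norm x \<and> norm x \<le> 1 \<and> x /\<^sub>R norm x \<in> sphere 0 1"
      using x by (auto simp: shadow_def)
    ultimately show "x \<in> ?L" by blast
  qed (auto simp: shadow_def kd)
  then show ?thesis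
    by (simp add: projection_volume_def sphere_volume_sphere) (simp add: sphere_volume_def)
qed

lemma scaleR_image_closure_cell:
  fixes V :: "'a::euclidean_space set"
  assumes "P \<subseteq> V" "cell V UNIV P \<noteq> {}" "t > 0"
  shows "(*\<^sub>R) t ` closure (cell V UNIV P) = closure (cell V UNIV P)"
proof -
  have "x \<in> (*\<^sub>R) t ` closure (cell V UNIV P)" if "x \<in> closure (cell V UNIV P)" for x
  proof (rule image_eqI)
    show "x = t *\<^sub>R (inverse t *\<^sub>R x)" using assms(3) by simp
    show "inverse t *\<^sub>R x \<in> closure (cell V UNIV P)"
      using that assms(3) unfolding closure_cell[OF assms(1,2)]
      by (auto simp: mult_le_0_iff zero_le_mult_iff)
  qed
  then show ?thesis
    using assms(3) unfolding closure_cell[OF assms(1,2)]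
    by (auto simp: mult_le_0_iff zero_le_mult_iff)
qed

lemma shadow_closure_cell:
  fixes V :: "'a::euclidean_space set"
  assumes V: "finite V" and P: "P \<subseteq> V" "cell V UNIV P \<noteq> {}"
  shows "shadow (closure (cell V UNIV P)) k =
     {y \<in> cball 0 1 - {0}. dim (min_flat V (closest_point (closure (cell V UNIV P)) y)) = k}"
proof -
  have "closest_point (closure (cell V UNIV P)) y \<in> closure (cell V UNIV P)" for y
    using P by (simp add: closest_point_in_set)
  then show ?thesis
    using k_dimensional_iff_dim_min_flat[OF V P] by (auto simp: shadow_def)
qed

text \<open>The projection is continuous, and up to intersection with the punctured ball the shadow
  is a finite union over the possible sets \<open>A\<close> of normals vanishing at the
  projection.\<close>

lemma shadow_closure_cell_borel:
  fixes V :: "'a::euclidean_space set"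
  assumes V: "finite V" and P: "P \<subseteq> V" "cell V UNIV P \<noteq> {}"
  shows "shadow (closure (cell V UNIV P)) k \<in> sets borel"
proof -
  let ?p = "closest_point (closure (cell V UNIV P))"
  have "continuous_on UNIV ?p"
    using P by (intro continuous_on_closest_point) (auto simp: convex_closure convex_cell)
  then have "closed {y. a \<bullet> ?p y = 0}" for a
    by (intro closed_Collect_eq continuous_intros)
  then have *: "{y \<in> space borel. a \<bullet> ?p y = 0} \<in> sets borel" for a
    by simp
  have "{y \<in> space borel. (a \<bullet> ?p y = 0) = (a \<in> A)} \<in> sets borel" for a A
    using * sets.sets_Collect_neg[OF *] by (cases "a \<in> A") simp_all
  then have "{y \<in> space borel. \<forall>a\<in>V. (a \<bullet> ?p y = 0) = (a \<in> A)} \<in> sets borel" for A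
    using V by (intro sets.sets_Collect_finite_All)
  then have "(\<Union>A\<in>{A \<in> Pow V. dim (orthogonal_comp A) = k}.
      {y \<in> space borel. \<forall>a\<in>V. (a \<bullet> ?p y = 0) = (a \<in> A)}) \<in> sets borel"
    using V by (intro sets.finite_UN) auto
  also have "(\<Union>A\<in>{A \<in> Pow V. dim (orthogonal_comp A) = k}.
      {y \<in> space borel. \<forall>a\<in>V. (a \<bullet> ?p y = 0) = (a \<in> A)}) = {y. dim (min_flat V (?p y)) = k}"
  proof -
    have "(\<forall>a\<in>V. (a \<bullet> ?p y = 0) = (a \<in> A)) \<longleftrightarrow> A = {a \<in> V. a \<bullet> ?p y = 0}" if "A \<subseteq> V" for A y
      using that by auto
    then show ?thesis by (auto simp: min_flat_def)
  qed
  finally have "{y. dim (min_flat V (?p y)) = k} \<in> sets borel" .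
  moreover have "shadow (closure (cell V UNIV P)) k = (cball 0 1 - {0}) \<inter> {y. dim (min_flat V (?p y)) = k}"
    unfolding shadow_closure_cell[OF assms] by auto
  ultimately show ?thesis by auto
qed

lemma component_is_cell:
  fixes V :: "'a::euclidean_space set"
  assumes "R \<in> components (- \<Union> ((\<lambda>a. {x. a \<bullet> x = 0}) ` V))"
  obtains P where "P \<subseteq> V" "cell V UNIV P \<noteq> {}" "R = cell V UNIV P"
  using assms[folded bij_betw_imp_surj_on[OF bij_betw_cells_components]] by blast

theorem sum_projection_volume_chambers:
  fixes V :: "'a::euclidean_space set"
  assumes V: "finite V" "0 \<notin> V"
  shows "(\<Sum>R\<in>components (- \<Union> ((\<lambda>a. {x. a \<bullet> x = 0}) ` V)). projection_volume (closure R) k)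
      = \<bar>of_int (coeff (characteristic_poly ((\<lambda>a. {x. a \<bullet> x = 0}) ` V)) k)\<bar>"
    (is "sum _ (components ?X) = ?a")
proof -
  let ?B = "cball 0 1 - {0} :: 'a set"
  have fin: "finite (components ?X)"
    using bij_betw_finite[OF bij_betw_cells_components[of V]] V(1) by simp
  have lm: "shadow (closure R) k \<in> lmeasurable" if R: "R \<in> components ?X" for R
  proof -
    obtain P where P: "P \<subseteq> V" "cell V UNIV P \<noteq> {}" "R = cell V UNIV P"
      using component_is_cell[OF R] .
    have "bounded (shadow (closure R) k)"
      by (rule bounded_subset[of "cball 0 1"]) (auto simp: shadow_def)
    then show ?thesis
      using shadow_closure_cell_borel[OF V(1) P(1,2)] P(3)
      by (intro bounded_set_imp_lmeasurable) auto
  qed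
  have B: "?B \<in> lmeasurable"
    by (intro bounded_set_imp_lmeasurable) (auto intro: bounded_subset[of "cball 0 1"])
  have int: "integrable lebesgue (indicat_real S)" if "S \<in> lmeasurable" for S :: "'a set"
    using that by (intro integrable_real_indicator) (auto simp: fmeasurable_def)
  have "(\<Sum>R\<in>components ?X. measure lebesgue (shadow (closure R) k))
      = (\<Sum>R\<in>components ?X. integral\<^sup>L lebesgue (indicat_real (shadow (closure R) k)))"
    by simp
  also have "\<dots> = (LINT y|lebesgue. (\<Sum>R\<in>components ?X. indicat_real (shadow (closure R) k) y))"
    using lm int by (intro Bochner_Integration.integral_sum[symmetric]) auto
  \<comment> \<open>For generic \<open>y\<close> in the punctured ball exactly \<open>?a\<close>
    shadows contain \<open>y\<close>; the remaining points of the ball form a null set.\<close>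
  also have "\<dots> = (LINT y|lebesgue. ?a * indicat_real ?B y)"
  proof (rule integral_cong_AE)
    show "(\<lambda>y. \<Sum>R\<in>components ?X. indicat_real (shadow (closure R) k) y) \<in> borel_measurable lebesgue"
      using lm int by (intro borel_measurable_sum) auto
    show "(\<lambda>y. ?a * indicat_real ?B y) \<in> borel_measurable lebesgue"
      using int[OF B] by (intro borel_measurable_times) auto
    show "AE y in lebesgue. (\<Sum>R\<in>components ?X. indicat_real (shadow (closure R) k) y) = ?a * indicat_real ?B y"
      using AE_min_flat_closest_point[OF V(1)]
    proof (rule AE_mp, intro AE_I2 impI)
      fix y :: 'a
      assume y: "\<forall>B\<subseteq>V. min_flat V (closest_point (orthogonal_comp B) y) = orthogonal_comp B"
      have "indicat_real (shadow (closure R) k) y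
          = (if dim (min_flat V (closest_point (closure R) y)) = k then 1 else 0) * indicat_real ?B y"
        if "R \<in> components ?X" for R
        by (rule component_is_cell[OF that]) (simp add: shadow_closure_cell[OF V(1)] indicator_def)
      then have "(\<Sum>R\<in>components ?X. indicat_real (shadow (closure R) k) y)
          = (\<Sum>R\<in>components ?X. if dim (min_flat V (closest_point (closure R) y)) = k then 1 else 0) * indicat_real ?B y"
        by (simp add: sum_distrib_right)
      then show "(\<Sum>R\<in>components ?X. indicat_real (shadow (closure R) k) y) = ?a * indicat_real ?B y"
        using fin card_chambers_dim_min_flat[OF V y, of k] by (simp add: sum.If_cases Int_def)
    qed
  qed
  also have "\<dots> = ?a * measure lebesgue ?B"
    by simp
  also have "measure lebesgue ?B = measure lebesgue (cball 0 1 :: 'a set)"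
    by (rule measure_negligible_symdiff) (auto intro: negligible_subset[of "{0}"])
  finally have *: "(\<Sum>R\<in>components ?X. measure lebesgue (shadow (closure R) k))
      = ?a * measure lebesgue (cball 0 1 :: 'a set)" .
  have "projection_volume (closure R) k
      = measure lebesgue (shadow (closure R) k) / measure lebesgue (cball 0 1 :: 'a set)"
    if R: "R \<in> components ?X" for R
  proof -
    obtain P where P: "P \<subseteq> V" "cell V UNIV P \<noteq> {}" "R = cell V UNIV P"
      using component_is_cell[OF R] .
    show ?thesis unfolding P(3) using P(1,2)
      by (intro projection_volume_eq_shadow scaleR_image_closure_cell) (auto simp: convex_closure convex_cell)
  qed
  moreover have "measure lebesgue (cball 0 1 :: 'a set) \<noteq> 0"
    using content_cball_pos[of 1 "0::'a"] by simp
  ultimately show ?thesis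
    using * by (simp flip: sum_divide_distrib)
qed

section \<open>Finite reflection groups\<close>

definition reflect :: "'a::real_inner \<Rightarrow> 'a \<Rightarrow> 'a"
  where "reflect a x = x - (2 * (x \<bullet> a) / (a \<bullet> a)) *\<^sub>R a"

lemma is_reflection_iff_reflect: "is_reflection f \<longleftrightarrow> (\<exists>a. a \<noteq> 0 \<and> f = reflect a)"
  by (auto simp: is_reflection_def reflect_def fun_eq_iff)

lemma mirror_reflect: "a \<noteq> 0 \<Longrightarrow> mirror (reflect a) = {x. a \<bullet> x = 0}" for a :: "'a::euclidean_space"
  using mirror_eq_hyperplane[of a "reflect a"] by (simp add: reflect_def fun_eq_iff inner_commute)

text \<open>Used to see that the group carries mirrors to mirrors.\<close>

lemma reflect_conjugate:
  fixes w v :: "'a::euclidean_space \<Rightarrow> 'a"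
  assumes "orthogonal_transformation w" "w \<circ> v = id"
  shows "w \<circ> reflect a \<circ> v = reflect (w a)"
proof
  fix x
  have "linear w" and ip: "\<And>x y. w x \<bullet> w y = x \<bullet> y"
    using assms(1) by (auto simp: orthogonal_transformation_def)
  moreover have wv: "w (v x) = x" using assms(2) by (metis comp_apply id_apply)
  ultimately have "(w \<circ> reflect a \<circ> v) x = x - (2 * (v x \<bullet> a) / (a \<bullet> a)) *\<^sub>R w a"
    by (simp add: reflect_def linear_diff linear_scale)
  then show "(w \<circ> reflect a \<circ> v) x = reflect (w a) x"
    using ip[of "v x" a] ip[of a a] wv by (simp add: reflect_def)
qed

text \<open>The reflection changes the squared distance to \<open>q\<close> by
  \<open>4 * ((a \<bullet> x) * (a \<bullet> q)) / (a \<bullet> a)\<close>.\<close>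

lemma dist_reflect_less:
  fixes a :: "'a::euclidean_space"
  assumes "a \<noteq> 0" "(a \<bullet> x) * (a \<bullet> q) < 0"
  shows "dist (reflect a x) q < dist x q"
proof -
  have aa: "a \<bullet> a > 0" using assms(1) by simp
  define c where "c = 2 * (a \<bullet> x) / (a \<bullet> a)"
  have ca: "c * (a \<bullet> a) = 2 * (a \<bullet> x)" using aa by (simp add: c_def)
  have expand: "(d - c *\<^sub>R a) \<bullet> (d - c *\<^sub>R a) = d \<bullet> d - 2 * c * (a \<bullet> d) + c * (c * (a \<bullet> a))" for d
    by (simp add: inner_diff_left inner_diff_right inner_commute[of d a] right_diff_distrib)
  have "reflect a x - q = (x - q) - c *\<^sub>R a"
    by (simp add: reflect_def c_def inner_commute)
  then have "(dist (reflect a x) q)\<^sup>2 = ((x - q) - c *\<^sub>R a) \<bullet> ((x - q) - c *\<^sub>R a)"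
    by (simp only: dist_norm power2_norm_eq_inner)
  also have "\<dots> = (dist x q)\<^sup>2 - 2 * c * (a \<bullet> (x - q)) + c * (c * (a \<bullet> a))"
    by (simp only: expand dist_norm power2_norm_eq_inner)
  also have "\<dots> = (dist x q)\<^sup>2 + 4 * ((a \<bullet> x) * (a \<bullet> q)) / (a \<bullet> a)"
    unfolding ca by (simp add: c_def inner_diff_right right_diff_distrib)
  also have "\<dots> < (dist x q)\<^sup>2"
  proof -
    have "4 * ((a \<bullet> x) * (a \<bullet> q)) / (a \<bullet> a) < 0"
      using assms(2) aa by (intro divide_neg_pos) linarith+
    then show ?thesis by linarith
  qed
  finally show ?thesis by (simp add: power_less_imp_less_base)
qed

text \<open>What the three types share. Inverses come from finiteness, and invariance of
  \<open>lborel\<close> transfers volumes between chambers.\<close>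

locale finite_volume_preserving_group =
  fixes W :: "('a::euclidean_space \<Rightarrow> 'a) set"
  assumes finite_W: "finite W"
    and id_mem: "id \<in> W"
    and comp_mem: "\<And>f g. f \<in> W \<Longrightarrow> g \<in> W \<Longrightarrow> f \<circ> g \<in> W"
    and orth: "\<And>f. f \<in> W \<Longrightarrow> orthogonal_transformation f"
    and lborel_invariant: "\<And>f. f \<in> W \<Longrightarrow> distr lborel borel f = lborel"
begin

abbreviation chambers :: "'a set set"
  where "chambers \<equiv> components (- \<Union> (reflection_arrangement W))"

lemma linear_mem: "w \<in> W \<Longrightarrow> linear w"
  and inj_mem: "w \<in> W \<Longrightarrow> inj w"
  using orth by (auto simp: orthogonal_transformation_linear orthogonal_transformation_inj)

text \<open>Composition with \<open>w\<close> is an injective self-map of the finite set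
  \<open>W\<close>, so it reaches \<open>id\<close>.\<close>

lemma inverse_mem:
  assumes "w \<in> W"
  obtains v where "v \<in> W" "w \<circ> v = id" "v \<circ> w = id"
proof -
  have "inj_on ((\<circ>) w) W"
    using inj_mem[OF assms] by (auto simp: inj_on_def fun_eq_iff)
  then have "(\<circ>) w ` W = W"
    using comp_mem[OF assms] finite_W by (intro endo_inj_surj) auto
  then have "id \<in> (\<circ>) w ` W" using id_mem by simp
  then obtain v where v: "v \<in> W" "w \<circ> v = id" by (metis imageE)
  moreover from v have "v \<circ> w = id"
    using inj_mem[OF assms] by (auto simp: fun_eq_iff inj_def)
  ultimately show thesis by (rule that)
qed

text \<open>Choosing one normal per reflection makes the results on finite families of normals
  applicable.\<close>

lemma normals_exist:
  obtains V where "finite V" "0 \<notin> V" "reflection_arrangement W = (\<lambda>a. {x. a \<bullet> x = 0}) ` V"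
proof -
  have "\<forall>f\<in>{f \<in> W. is_reflection f}. \<exists>a. a \<noteq> 0 \<and> f = reflect a"
    by (simp add: is_reflection_iff_reflect)
  then obtain n where n: "\<And>f. f \<in> {f \<in> W. is_reflection f} \<Longrightarrow> n f \<noteq> 0 \<and> f = reflect (n f)"
    by metis
  show thesis
  proof (rule that[of "n ` {f \<in> W. is_reflection f}"])
    have "mirror f = {x. n f \<bullet> x = 0}" if "f \<in> {f \<in> W. is_reflection f}" for f
      using n[OF that] mirror_reflect[of "n f"] by metis
    then show "reflection_arrangement W = (\<lambda>a. {x. a \<bullet> x = 0}) ` n ` {f \<in> W. is_reflection f}"
      unfolding reflection_arrangement_def image_image by (intro image_cong) auto
  qed (use n finite_W in force)+
qed

lemma arrangement_invariant:
  assumes w: "w \<in> W" and x: "w x \<in> \<Union> (reflection_arrangement W)"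
  shows "x \<in> \<Union> (reflection_arrangement W)"
proof -
  obtain a where a: "reflect a \<in> W" "a \<noteq> 0" "a \<bullet> w x = 0"
    using x mirror_reflect by (auto simp: reflection_arrangement_def is_reflection_iff_reflect)
  obtain v where v: "v \<in> W" "w \<circ> v = id" "v \<circ> w = id" using inverse_mem[OF w] .
  \<comment> \<open>Conjugation by the inverse \<open>v\<close> carries the mirror through
    \<open>w x\<close> back to one through \<open>x\<close>.\<close>
  have "reflect (v a) \<in> W"
    using reflect_conjugate[OF orth[OF v(1)] v(3)] a(1) v(1) w comp_mem by metis
  moreover have "v a \<noteq> 0"
    using a(2) inj_mem[OF v(1)] linear_mem[OF v(1)] by (metis injD linear_0)
  moreover have "v a \<bullet> x = 0"
    using a(3) orth[OF v(1)] v(3) by (metis comp_apply id_apply orthogonal_transformation_def)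
  ultimately have "x \<in> mirror (reflect (v a))" "reflect (v a) \<in> {f \<in> W. is_reflection f}"
    using mirror_reflect[of "v a"] is_reflection_iff_reflect[of "reflect (v a)"] by auto
  then show ?thesis unfolding reflection_arrangement_def by blast
qed

lemma image_avoids_arrangement:
  assumes "w \<in> W" "R \<subseteq> - \<Union> (reflection_arrangement W)"
  shows "w ` R \<subseteq> - \<Union> (reflection_arrangement W)"
  using arrangement_invariant[OF assms(1)] assms(2) by blast

text \<open>Choose \<open>w\<close> bringing \<open>p\<close> as near to \<open>q\<close> as
  possible. A mirror met by the segment from \<open>w p\<close> to \<open>q\<close> would strictly
  separate its ends, and reflecting in it would shorten the distance. So the segment stays in
  \<open>R'\<close>.\<close>

lemma chambers_transitive:
  assumes R: "R \<in> chambers" and R': "R' \<in> chambers"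
  obtains w where "w \<in> W" "w ` R = R'"
proof -
  let ?X = "- \<Union> (reflection_arrangement W)"
  obtain p q where p: "p \<in> R" and q: "q \<in> R'"
    using R R' in_components_nonempty by blast
  obtain w where w: "w \<in> W" "\<And>v. v \<in> W \<Longrightarrow> dist (w p) q \<le> dist (v p) q"
    using arg_min_if_finite[OF finite_W, of "\<lambda>w. dist (w p) q"] id_mem
    by (metis empty_iff linorder_not_le)
  have Rsub: "R \<subseteq> ?X" "R' \<subseteq> ?X" using R R' in_components_subset by blast+
  have wR: "connected (w ` R)" "w ` R \<subseteq> ?X"
    using image_avoids_arrangement[OF w(1) Rsub(1)] in_components_connected[OF R] linear_mem[OF w(1)]
    by (auto simp: connected_linear_image)
  have seg: "closed_segment (w p) q \<subseteq> ?X"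
  proof (rule ccontr)
    assume "\<not> ?thesis"
    then obtain a z where a: "reflect a \<in> W" "a \<noteq> 0" and z: "z \<in> closed_segment (w p) q" "a \<bullet> z = 0"
      using mirror_reflect by (auto simp: reflection_arrangement_def is_reflection_iff_reflect)
    have "{x. a \<bullet> x = 0} \<in> reflection_arrangement W"
      using a by (auto simp: reflection_arrangement_def is_reflection_iff_reflect mirror_reflect[symmetric])
    then have nz: "a \<bullet> w p \<noteq> 0" "a \<bullet> q \<noteq> 0"
      using wR(2) Rsub(2) p q by auto
    have "(a \<bullet> w p) * (a \<bullet> q) < 0"
    proof (rule ccontr)
      assume "\<not> ?thesis"
      then consider "a \<bullet> w p > 0" "a \<bullet> q > 0" | "a \<bullet> w p < 0" "a \<bullet> q < 0"
        using nz by (auto simp: mult_less_0_iff not_less)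
      then show False
      proof cases
        case 1
        then have "closed_segment (w p) q \<subseteq> {x. a \<bullet> x > 0}"
          by (intro closed_segment_subset convex_halfspace_gt) auto
        then show False using z by auto
      next
        case 2
        then have "closed_segment (w p) q \<subseteq> {x. a \<bullet> x < 0}"
          by (intro closed_segment_subset convex_halfspace_lt) auto
        then show False using z by auto
      qed
    qed
    then have "dist (reflect a (w p)) q < dist (w p) q"
      using a(2) by (rule dist_reflect_less[rotated])
    then show False
      using w(2)[OF comp_mem[OF a(1) w(1)]] by simp
  qed
  have "w ` R \<subseteq> R'"
  proof (rule components_maximal[OF R'])
    have "w p \<in> R'"
      using components_maximal[OF R' _ seg] q by auto
    then show "R' \<inter> w ` R \<noteq> {}" using p by blast
  qed (use wR in auto)
  obtain v where v: "v \<in> W" "w \<circ> v = id" "v \<circ> w = id" using inverse_mem[OF w(1)] .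
  \<comment> \<open>The same maximality argument for the inverse gives the other inclusion.\<close>
  have "v ` R' \<subseteq> R"
  proof (rule components_maximal[OF R])
    have "v (w p) = p" using v(3) by (metis comp_apply id_apply)
    then show "R \<inter> v ` R' \<noteq> {}" using \<open>w ` R \<subseteq> R'\<close> p by (metis Int_iff empty_iff image_eqI subsetD)
    show "connected (v ` R')"
      using in_components_connected[OF R'] linear_mem[OF v(1)] by (auto simp: connected_linear_image)
  qed (use image_avoids_arrangement[OF v(1) Rsub(2)] in auto)
  moreover have "w ` v ` R' = R'" using v(2) by (simp add: image_comp)
  ultimately have "R' \<subseteq> w ` R" by blast
  with \<open>w ` R \<subseteq> R'\<close> w(1) show thesis by (intro that) auto
qed

text \<open>An element \<open>w\<close> carrying one chamber to the other is an isometry, so it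
  commutes with projection and pulls one shadow back to the other; it also preserves Lebesgue
  measure.\<close>

lemma projection_volume_chamber:
  assumes R: "R \<in> chambers" and R': "R' \<in> chambers"
  shows "projection_volume (closure R) k = projection_volume (closure R') k"
proof -
  obtain V where V: "finite V" "reflection_arrangement W = (\<lambda>a. {x. a \<bullet> x = 0}) ` V"
    using normals_exist .
  obtain w where w: "w \<in> W" "w ` R = R'" using chambers_transitive[OF R R'] .
  obtain P where P: "P \<subseteq> V" "cell V UNIV P \<noteq> {}" "R = cell V UNIV P"
    using component_is_cell[OF R[unfolded V(2)]] .
  obtain P' where P': "P' \<subseteq> V" "cell V UNIV P' \<noteq> {}" "R' = cell V UNIV P'"
    using component_is_cell[OF R'[unfolded V(2)]] .
  have C: "closed (closure R)" "convex (closure R)" "closure R \<noteq> {}"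
    using P by (auto simp: convex_closure convex_cell)
  have norm: "norm (w x) = norm x" for x
    using orth[OF w(1)] by (simp add: orthogonal_transformation)
  have img: "closure R' = w ` closure R"
    using closure_injective_linear_image[OF linear_mem[OF w(1)] inj_mem[OF w(1)], of R] w(2) by simp
  have "k_dimensional (closure R') k (closest_point (closure R') (w y))
      \<longleftrightarrow> k_dimensional (closure R) k (closest_point (closure R) y)" for y
    unfolding img using closest_point_similarity[of w 1 "closure R" y] norm C linear_mem[OF w(1)]
      k_dimensional_linear_image[OF linear_mem[OF w(1)] inj_mem[OF w(1)]] by simp
  then have vimage: "w -` shadow (closure R') k = shadow (closure R) k"
    using norm by (auto simp: shadow_def) (metis norm norm_eq_zero)+
  have borel: "shadow (closure R) k \<in> sets borel" "shadow (closure R') k \<in> sets borel"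
    using shadow_closure_cell_borel[OF V(1)] P P' by auto
  have "w \<in> borel_measurable borel"
    using linear_mem[OF w(1)] by (simp add: borel_measurable_continuous_onI linear_continuous_on linear_conv_bounded_linear)
  then have "measure lborel (shadow (closure R') k) = measure lborel (w -` shadow (closure R') k)"
    using lborel_invariant[OF w(1)] measure_distr[of w lborel borel "shadow (closure R') k"] borel by simp
  then have "measure lebesgue (shadow (closure R') k) = measure lebesgue (shadow (closure R) k)"
    using borel unfolding vimage by simp
  moreover have "projection_volume (closure R) k
      = measure lebesgue (shadow (closure R) k) / measure lebesgue (cball 0 1 :: 'a set)"
    using P C scaleR_image_closure_cell[OF P(1,2)] by (intro projection_volume_eq_shadow) auto
  moreover have "projection_volume (closure R') k
      = measure lebesgue (shadow (closure R') k) / measure lebesgue (cball 0 1 :: 'a set)"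
    using P' scaleR_image_closure_cell[OF P'(1,2)]
    by (intro projection_volume_eq_shadow) (auto simp: convex_closure convex_cell)
  ultimately show ?thesis by simp
qed

theorem projection_volume_proportional:
  assumes "fundamental_chamber W C"
  shows "projection_volume C k = 1 / real (card chambers)
           * \<bar>of_int (coeff (characteristic_poly (reflection_arrangement W)) k)\<bar>"
    and "card chambers > 0"
proof -
  obtain R where R: "R \<in> chambers" "C = closure R"
    using assms by (auto simp: fundamental_chamber_def)
  obtain V where V: "finite V" "0 \<notin> V" "reflection_arrangement W = (\<lambda>a. {x. a \<bullet> x = 0}) ` V"
    using normals_exist .
  have "finite chambers"
    unfolding V(3) using bij_betw_finite[OF bij_betw_cells_components[of V]] V(1) by simp
  then show card: "card chambers > 0" using R(1) by (auto simp: card_gt_0_iff)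
  have "real (card chambers) * projection_volume C k
      = (\<Sum>R\<in>chambers. projection_volume (closure R) k)"
    using projection_volume_chamber[OF _ R(1), of _ k] R(2) by simp
  also have "\<dots> = \<bar>of_int (coeff (characteristic_poly (reflection_arrangement W)) k)\<bar>"
    unfolding V(3) by (rule sum_projection_volume_chambers[OF V(1,2)])
  finally show "projection_volume C k = 1 / real (card chambers)
           * \<bar>of_int (coeff (characteristic_poly (reflection_arrangement W)) k)\<bar>"
    using card by (simp add: field_simps)
qed

end

section \<open>Groups of signed permutations\<close>

lemma prod_Basis_cart: "(\<Prod>b\<in>Basis. g b) = (\<Prod>i\<in>UNIV. g (axis i 1))"
  for g :: "real^'m::finite \<Rightarrow> real"
proof -
  have "(Basis :: (real^'m) set) = (\<lambda>i. axis i 1) ` UNIV"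
    by (auto simp: Basis_vec_def)
  moreover have "inj (\<lambda>i. axis i (1::real) :: real^'m)"
    by (simp add: inj_on_def axis_eq_axis)
  ultimately show ?thesis
    by (metis (no_types, lifting) comp_apply prod.cong prod.reindex)
qed

lemma linear_signed_perm: "linear (signed_perm s p)"
  by (rule linearI) (auto simp: signed_perm_def vec_eq_iff algebra_simps)

text \<open>The permutations compose in reverse order because they act on indices by
  pullback.\<close>

lemma signed_perm_comp:
  "signed_perm s p \<circ> signed_perm s' p' = signed_perm (\<lambda>i. s i * s' (p i)) (p' \<circ> p)"
  by (auto simp: signed_perm_def fun_eq_iff vec_eq_iff)

text \<open>Lebesgue measure is determined by its values on boxes, and the preimage of a box is a
  box with the same edge lengths in another order.\<close>

lemma lborel_distr_signed_perm:
  fixes p :: "'m::finite \<Rightarrow> 'm"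
  assumes p: "bij p" and s: "\<And>i. s i \<in> {1, -1}"
  shows "distr lborel borel (signed_perm s p) = lborel"
proof (rule lborel_eqI[symmetric])
  fix l u :: "real^'m" assume le: "\<And>b. b \<in> Basis \<Longrightarrow> l \<bullet> b \<le> u \<bullet> b"
  then have le': "l $ i \<le> u $ i" for i
    using le[of "axis i 1"] by (simp add: inner_axis axis_in_Basis_iff)
  define q where "q = inv p"
  have qp: "q (p i) = i" "p (q i) = i" for i
    using p by (simp_all add: q_def bij_is_inj bij_is_surj surj_f_inv_f)
  \<comment> \<open>Coordinate \<open>j\<close> of the argument appears at index \<open>q j\<close>
    of the image; a sign -1 there negates and exchanges the interval ends.\<close>
  define l' :: "real^'m" where "l' = (\<chi> j. if s (q j) = 1 then l $ q j else - u $ q j)"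
  define u' :: "real^'m" where "u' = (\<chi> j. if s (q j) = 1 then u $ q j else - l $ q j)"
  have meas: "signed_perm s p \<in> borel_measurable borel"
    using linear_signed_perm[of s p]
    by (simp add: borel_measurable_continuous_onI linear_continuous_on linear_conv_bounded_linear)
  have "signed_perm s p -` box l u = box l' u'"
  proof (intro set_eqI)
    fix x
    have "x \<in> signed_perm s p -` box l u \<longleftrightarrow> (\<forall>i. l $ i < s i * x $ p i \<and> s i * x $ p i < u $ i)"
      by (simp add: mem_box_cart signed_perm_def)
    also have "\<dots> \<longleftrightarrow> (\<forall>j. l $ q j < s (q j) * x $ j \<and> s (q j) * x $ j < u $ q j)"
      using qp by metis
    also have "\<dots> \<longleftrightarrow> (\<forall>j. l' $ j < x $ j \<and> x $ j < u' $ j)"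
    proof (intro all_cong1)
      fix j show "(l $ q j < s (q j) * x $ j \<and> s (q j) * x $ j < u $ q j) \<longleftrightarrow> (l' $ j < x $ j \<and> x $ j < u' $ j)"
        using s[of "q j"] by (auto simp: l'_def u'_def)
    qed
    finally show "x \<in> signed_perm s p -` box l u \<longleftrightarrow> x \<in> box l' u'"
      by (simp add: mem_box_cart)
  qed
  then have "emeasure (distr lborel borel (signed_perm s p)) (box l u) = emeasure lborel (box l' u')"
    using meas by (simp add: emeasure_distr)
  also have "\<dots> = ennreal (\<Prod>b\<in>Basis. (u' - l') \<bullet> b)"
    using le' by (intro emeasure_lborel_box) (auto simp: Basis_vec_def inner_axis l'_def u'_def)
  also have "(\<Prod>b\<in>Basis. (u' - l') \<bullet> b) = (\<Prod>j\<in>UNIV. u $ q j - l $ q j)"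
    by (auto simp: prod_Basis_cart inner_axis l'_def u'_def intro!: prod.cong)
  also have "\<dots> = (\<Prod>i\<in>UNIV. u $ i - l $ i)"
    using p by (intro prod.reindex_bij_betw) (simp add: q_def bij_imp_bij_inv)
  also have "\<dots> = (\<Prod>b\<in>Basis. (u - l) \<bullet> b)"
    by (simp add: prod_Basis_cart inner_axis)
  finally show "emeasure (distr lborel borel (signed_perm s p)) (box l u) = ennreal (\<Prod>b\<in>Basis. (u - l) \<bullet> b)" .
qed simp

lemma orthogonal_signed_perm:
  fixes p :: "'m::finite \<Rightarrow> 'm"
  assumes p: "bij p" and s: "\<And>i. s i \<in> {1, -1}"
  shows "orthogonal_transformation (signed_perm s p)"
  unfolding orthogonal_transformation_def
proof (intro conjI linear_signed_perm allI)
  fix x y :: "real^'m"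
  have ss: "s i * s i = 1" for i using s[of i] by auto
  have "signed_perm s p x \<bullet> signed_perm s p y = (\<Sum>i\<in>UNIV. (s i * s i) * (x $ p i * y $ p i))"
    by (simp add: inner_vec_def signed_perm_def mult_ac)
  also have "\<dots> = (\<Sum>i\<in>UNIV. x $ p i * y $ p i)" by (simp add: ss)
  also have "\<dots> = (\<Sum>i\<in>UNIV. x $ i * y $ i)"
    using p by (intro sum.reindex_bij_betw)
  finally show "signed_perm s p x \<bullet> signed_perm s p y = x \<bullet> y"
    by (simp add: inner_vec_def)
qed

lemma signed_perm_group:
  fixes W :: "(real^'m::finite \<Rightarrow> real^'m) set"
  assumes W: "W \<subseteq> {signed_perm s p | s p. bij p \<and> (\<forall>i. s i \<in> {1, -1})}"
    and "id \<in> W" "\<And>f g. f \<in> W \<Longrightarrow> g \<in> W \<Longrightarrow> f \<circ> g \<in> W"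
  shows "finite_volume_preserving_group W"
proof
  have "W \<subseteq> (\<lambda>(s, p). signed_perm s p) ` ((UNIV \<rightarrow>\<^sub>E {1, -1}) \<times> UNIV)"
    using W by (fastforce simp: PiE_def)
  then show "finite W"
    by (rule finite_subset) (simp add: finite_PiE)
qed (use assms orthogonal_signed_perm lborel_distr_signed_perm in blast)+

lemma id_eq_signed_perm: "id = signed_perm (\<lambda>_. 1) id"
  by (auto simp: signed_perm_def fun_eq_iff)

text \<open>Unlike the number of sign changes, the product of the signs is multiplicative.\<close>

lemma prod_signs:
  fixes s :: "'m::finite \<Rightarrow> real"
  assumes "\<And>i. s i \<in> {1, -1}"
  shows "(\<Prod>i\<in>UNIV. s i) = (-1) ^ card {i. s i = -1}"
proof -
  have "(\<Prod>i\<in>UNIV. s i) = (\<Prod>i\<in>UNIV. if s i = -1 then -1 else 1)"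
    using assms by (intro prod.cong) auto
  also have "\<dots> = (-1) ^ card {i. s i = -1}"
    by (simp add: prod.If_cases)
  finally show ?thesis .
qed

lemma even_sign_changes_iff:
  fixes s :: "'m::finite \<Rightarrow> real"
  assumes "\<And>i. s i \<in> {1, -1}"
  shows "even (card {i. s i = -1}) \<longleftrightarrow> (\<Prod>i\<in>UNIV. s i) = 1"
  unfolding prod_signs[OF assms] by (cases "even (card {i. s i = -1})") auto

section \<open>Types A, B and D as instances\<close>

lemma type_A_group: "type_A n W \<Longrightarrow> finite_volume_preserving_group W"
proof (rule signed_perm_group)
  assume "type_A n W"
  then have W: "W = {signed_perm (\<lambda>_. 1) p | p. bij p}"
    by (simp add: type_A_def coord_perm_eq_signed_perm)
  show "W \<subseteq> {signed_perm s p | s p. bij p \<and> (\<forall>i. s i \<in> {1, -1})}"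
    unfolding W by blast
  show "id \<in> W" unfolding W id_eq_signed_perm using bij_id by blast
  show "f \<circ> g \<in> W" if "f \<in> W" "g \<in> W" for f g
  proof -
    obtain p q where "f = signed_perm (\<lambda>_. 1) p" "g = signed_perm (\<lambda>_. 1) q" "bij p" "bij q"
      using \<open>f \<in> W\<close> \<open>g \<in> W\<close> W by blast
    then have "f \<circ> g = signed_perm (\<lambda>_. 1) (q \<circ> p)" "bij (q \<circ> p)"
      by (simp_all add: signed_perm_comp bij_comp)
    then show ?thesis using W by blast
  qed
qed

lemma type_B_group: "type_B n W \<Longrightarrow> finite_volume_preserving_group W"
proof (rule signed_perm_group)
  assume "type_B n W"
  then have W: "W = {signed_perm s p | s p. bij p \<and> (\<forall>i. s i \<in> {1, -1})}"
    by (simp add: type_B_def)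
  then show "W \<subseteq> {signed_perm s p | s p. bij p \<and> (\<forall>i. s i \<in> {1, -1})}"
    by blast
  show "id \<in> W" unfolding W id_eq_signed_perm using bij_id by blast
  show "f \<circ> g \<in> W" if "f \<in> W" "g \<in> W" for f g
  proof -
    obtain s p t q where f: "f = signed_perm s p" "bij p" "\<forall>i. s i \<in> {1, -1}"
      and g: "g = signed_perm t q" "bij q" "\<forall>i. t i \<in> {1, -1}"
      using \<open>f \<in> W\<close> \<open>g \<in> W\<close> W by blast
    have "s i * t (p i) \<in> {1, -1}" for i
      using f(3)[rule_format, of i] g(3)[rule_format, of "p i"] by auto
    then show ?thesis
      unfolding W f(1) g(1) signed_perm_comp using bij_comp[OF f(2) g(2)] by blast
  qed
qed

lemma type_D_group: "type_D n W \<Longrightarrow> finite_volume_preserving_group W"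
proof (rule signed_perm_group)
  assume "type_D n W"
  then have W: "W = {signed_perm s p | s p. bij p \<and> (\<forall>i. s i \<in> {1, -1}) \<and> even (card {i. s i = -1})}"
    by (simp add: type_D_def)
  then show "W \<subseteq> {signed_perm s p | s p. bij p \<and> (\<forall>i. s i \<in> {1, -1})}"
    by blast
  have "even (card {i :: 'a. (1::real) = -1})" "\<forall>i :: 'a. (1::real) \<in> {1, -1}" by simp_all
  then show "id \<in> W" unfolding W id_eq_signed_perm using bij_id by blast
  show "f \<circ> g \<in> W" if "f \<in> W" "g \<in> W" for f g
  proof -
    obtain s p t q where f: "f = signed_perm s p" "bij p" "\<And>i. s i \<in> {1, -1}" "even (card {i. s i = -1})"
      and g: "g = signed_perm t q" "bij q" "\<And>i. t i \<in> {1, -1}" "even (card {i. t i = -1})"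
      using \<open>f \<in> W\<close> \<open>g \<in> W\<close> W by blast
    let ?r = "\<lambda>i. s i * t (p i)"
    have r: "?r i \<in> {1, -1}" for i
      using f(3)[of i] g(3)[of "p i"] by auto
    \<comment> \<open>Since \<open>p\<close> only reorders the factors of \<open>t\<close>, the sign
      product of the composite is the product of the two sign products.\<close>
    have "(\<Prod>i\<in>UNIV. t (p i)) = (\<Prod>i\<in>UNIV. t i)"
      using f(2) by (intro prod.reindex_bij_betw)
    then have "(\<Prod>i\<in>UNIV. ?r i) = 1"
      using f(4) g(4) unfolding even_sign_changes_iff[OF f(3)] even_sign_changes_iff[OF g(3)]
      by (simp add: prod.distrib)
    then have "even (card {i. ?r i = -1})"
      unfolding even_sign_changes_iff[OF r] .
    then show ?thesis
      unfolding W f(1) g(1) signed_perm_comp using bij_comp[OF f(2) g(2)] r by blast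
  qed
qed

theorem corollary5:
  fixes n :: nat
    and W :: "(real^'m::finite \<Rightarrow> real^'m) set"
    and C :: "(real^'m) set"
  assumes "type_A n W \<or> type_B n W \<or> type_D n W"
    and "fundamental_chamber W C"
  shows "\<exists>c::real. c > 0 \<and> (\<forall>k::nat. projection_volume C k
           = c * \<bar>of_int (coeff (characteristic_poly (reflection_arrangement W)) k)\<bar>)"
proof -
  interpret finite_volume_preserving_group W
    using assms(1) type_A_group type_B_group type_D_group by blast
  show ?thesis
    using projection_volume_proportional[OF assms(2)]
    by (intro exI[of _ "1 / real (card chambers)"]) auto
qed

end
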